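(* Given a free game $G$ of size $n$, there is a deterministic algorithm running in time $n^{O(\varepsilon^{-1}\log n)}$ that decides whether $\omega(G)=1$ or $\omega(G)\le1-\varepsilon$ (promised that one of these holds), and there is a deterministic algorithm running in time $n^{O(1+\frac{\log n}{\log(1/\delta)})}$ that decides whether $\omega(G)=1$ or $\omega(G)<\delta$ (promised that one of these holds).
   Context: A free game $G=(X,Y,A,B,V)$ consists of finite sets $X,Y,A,B$ and $V:X\times Y\times A\times B\to[0,1]$, given explicitly; its value is $\omega(G)=\max_{a:X\to A,b:Y\to B}\mathbb{E}_{x\in X,y\in Y}[V(x,y,a(x),b(y))]$ with $x,y$ independent uniform; its size is $n=|X||Y||A||B|$. *)

theory Defs
  imports "HOL-Probability.Probability"
begin

record ('x, 'y, 'a, 'b) free_game =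
  questions1 :: "'x set"
  questions2 :: "'y set"
  answers1 :: "'a set"
  answers2 :: "'b set"
  payoff :: "'x \<Rightarrow> 'y \<Rightarrow> 'a \<Rightarrow> 'b \<Rightarrow> real"

definition is_free_game :: "('x, 'y, 'a, 'b) free_game \<Rightarrow> bool" where
  "is_free_game G \<longleftrightarrow>
     finite (questions1 G) \<and> questions1 G \<noteq> {} \<and>
     finite (questions2 G) \<and> questions2 G \<noteq> {} \<and>
     finite (answers1 G) \<and> answers1 G \<noteq> {} \<and>
     finite (answers2 G) \<and> answers2 G \<noteq> {} \<and>
     (\<forall>x\<in>questions1 G. \<forall>y\<in>questions2 G. \<forall>a\<in>answers1 G. \<forall>b\<in>answers2 G.
        payoff G x y a b \<in> {0..1})"

definition game_size :: "('x, 'y, 'a, 'b) free_game \<Rightarrow> nat" where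
  "game_size G =
     card (questions1 G) * card (questions2 G) * card (answers1 G) * card (answers2 G)"

definition strategy_value ::
  "('x, 'y, 'a, 'b) free_game \<Rightarrow> ('x \<Rightarrow> 'a) \<Rightarrow> ('y \<Rightarrow> 'b) \<Rightarrow> real" where
  "strategy_value G a b =
     measure_pmf.expectation
       (pair_pmf (pmf_of_set (questions1 G)) (pmf_of_set (questions2 G)))
       (\<lambda>(x, y). payoff G x y (a x) (b y))"

definition game_value :: "('x, 'y, 'a, 'b) free_game \<Rightarrow> real" where
  "game_value G =
     Max {strategy_value G a b | a b.
            a \<in> questions1 G \<rightarrow>\<^sub>E answers1 G \<and> b \<in> questions2 G \<rightarrow>\<^sub>E answers2 G}"

text \<open>
  Algorithms are while programs for a unit-cost random access machine. The machine has
  finitely many program-addressed registers in use and an unbounded indirectly addressed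
  memory, each in one bank for natural numbers and one for reals (the payoffs and the threshold
  parameter are arbitrary reals). Two restrictions keep unit cost honest. There is no
  multiplication, so values grow at most exponentially in the running time and, on rational
  inputs, a Turing machine simulates the machine with polynomial overhead. The real constants
  of a program are natural numbers, so that no information can be hidden in them, and reals can
  only be moved, added, subtracted and compared; in particular they cannot be rounded or used as
  addresses.
\<close>

record ram_state =
  nreg :: "nat \<Rightarrow> nat"
  nmem :: "nat \<Rightarrow> nat"
  rreg :: "nat \<Rightarrow> real"
  rmem :: "nat \<Rightarrow> real"

datatype instr =
    NConst nat nat
  | NAdd nat nat nat
  | NSub nat nat nat
  | NLoad nat nat
  | NStore nat nat
  | RConst nat nat
  | RAdd nat nat nat
  | RSub nat nat nat
  | RLoad nat nat
  | RStore nat nat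

fun step :: "instr \<Rightarrow> ram_state \<Rightarrow> ram_state" where
  "step (NConst i c) s = s\<lparr>nreg := (nreg s)(i := c)\<rparr>"
| "step (NAdd i j k) s = s\<lparr>nreg := (nreg s)(i := nreg s j + nreg s k)\<rparr>"
| "step (NSub i j k) s = s\<lparr>nreg := (nreg s)(i := nreg s j - nreg s k)\<rparr>"
| "step (NLoad i j) s = s\<lparr>nreg := (nreg s)(i := nmem s (nreg s j))\<rparr>"
| "step (NStore i j) s = s\<lparr>nmem := (nmem s)(nreg s i := nreg s j)\<rparr>"
| "step (RConst i c) s = s\<lparr>rreg := (rreg s)(i := real c)\<rparr>"
| "step (RAdd i j k) s = s\<lparr>rreg := (rreg s)(i := rreg s j + rreg s k)\<rparr>"
| "step (RSub i j k) s = s\<lparr>rreg := (rreg s)(i := rreg s j - rreg s k)\<rparr>"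
| "step (RLoad i j) s = s\<lparr>rreg := (rreg s)(i := rmem s (nreg s j))\<rparr>"
| "step (RStore i j) s = s\<lparr>rmem := (rmem s)(nreg s i := rreg s j)\<rparr>"

datatype test = NLess nat nat | RLess nat nat

fun holds :: "test \<Rightarrow> ram_state \<Rightarrow> bool" where
  "holds (NLess i j) s \<longleftrightarrow> nreg s i < nreg s j"
| "holds (RLess i j) s \<longleftrightarrow> rreg s i < rreg s j"

datatype prog =
    Skip
  | Do instr
  | Seq prog prog
  | Cond test prog prog
  | While test prog

text \<open>\<open>exec P s t s'\<close>: started in \<open>s\<close>, the program \<open>P\<close> halts in \<open>s'\<close> after exactly
  \<open>t\<close> steps, every instruction and every evaluation of a test counting as one step.\<close>

inductive exec :: "prog \<Rightarrow> ram_state \<Rightarrow> nat \<Rightarrow> ram_state \<Rightarrow> bool" where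
  Skip: "exec Skip s 1 s"
| Do: "exec (Do i) s 1 (step i s)"
| Seq: "exec P s t s' \<Longrightarrow> exec Q s' u s'' \<Longrightarrow> exec (Seq P Q) s (t + u) s''"
| CondT: "holds c s \<Longrightarrow> exec P s t s' \<Longrightarrow> exec (Cond c P Q) s (t + 1) s'"
| CondF: "\<not> holds c s \<Longrightarrow> exec Q s t s' \<Longrightarrow> exec (Cond c P Q) s (t + 1) s'"
| WhileF: "\<not> holds c s \<Longrightarrow> exec (While c P) s 1 s"
| WhileT: "holds c s \<Longrightarrow> exec P s t s' \<Longrightarrow> exec (While c P) s' u s''
    \<Longrightarrow> exec (While c P) s (t + u + 1) s''"

inductive_cases exec_SkipE: "exec Skip s t s'"
inductive_cases exec_DoE: "exec (Do i) s t s'"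
inductive_cases exec_SeqE: "exec (Seq P Q) s t s'"
inductive_cases exec_CondE: "exec (Cond c P Q) s t s'"
inductive_cases exec_WhileE: "exec (While c P) s t s'"

lemma exec_deterministic:
  assumes "exec P s t s'" and "exec P s u s''"
  shows "t = u \<and> s' = s''"
  using assms
proof (induction arbitrary: u s'' rule: exec.induct)
  case (Skip s)
  then show ?case by (rule exec_SkipE) simp
next
  case (Do i s)
  then show ?case by (rule exec_DoE) simp
next
  case (Seq P s t s' Q v r)
  from Seq.prems obtain t1 s1 u1 where "exec P s t1 s1" "exec Q s1 u1 s''" "u = t1 + u1"
    by (rule exec_SeqE)
  with Seq.IH(1)[of t1 s1] Seq.IH(2)[of u1 s''] show ?case by simp
next
  case (CondT c s P t s' Q)
  from CondT.prems obtain t1 where "exec P s t1 s''" "u = Suc t1"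
    by (rule exec_CondE) (use CondT.hyps(1) in blast)+
  with CondT.IH[of t1 s''] show ?case by simp
next
  case (CondF c s Q t s' P)
  from CondF.prems obtain t1 where "exec Q s t1 s''" "u = Suc t1"
    by (rule exec_CondE) (use CondF.hyps(1) in blast)+
  with CondF.IH[of t1 s''] show ?case by simp
next
  case (WhileF c s P)
  from WhileF.prems show ?case
    by (rule exec_WhileE) (use WhileF.hyps in simp_all)
next
  case (WhileT c s P t s' v r)
  from WhileT.prems obtain t1 s1 u1
    where "exec P s t1 s1" "exec (While c P) s1 u1 s''" "u = Suc (t1 + u1)"
    by (rule exec_WhileE) (use WhileT.hyps(1) in blast)+
  with WhileT.IH(1)[of t1 s1] WhileT.IH(2)[of u1 s''] show ?case by simp
qed

definition accepting :: "ram_state \<Rightarrow> bool" where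
  "accepting s \<longleftrightarrow> nreg s 0 = 1"

definition enumerates :: "'c list \<Rightarrow> 'c set \<Rightarrow> bool" where
  "enumerates cs S \<longleftrightarrow> distinct cs \<and> set cs = S"

definition payoff_table ::
  "('x, 'y, 'a, 'b) free_game \<Rightarrow> 'x list \<Rightarrow> 'y list \<Rightarrow> 'a list \<Rightarrow> 'b list \<Rightarrow> real list" where
  "payoff_table G xs ys us vs =
     map (\<lambda>(x, y, a, b). payoff G x y a b)
       (List.product xs (List.product ys (List.product us vs)))"

text \<open>The explicit description of a game, relative to enumerations of its four sets: the four
  cardinalities and the table of all payoffs in row-major order, so that programs refer to the
  elements of these sets by their positions. The real parameter \<open>\<theta>\<close> is the
  threshold (\<open>\<epsilon>\<close> or \<open>\<delta>\<close>) of the promise problem.\<close>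

definition input_state ::
  "('x, 'y, 'a, 'b) free_game \<Rightarrow> 'x list \<Rightarrow> 'y list \<Rightarrow> 'a list \<Rightarrow> 'b list \<Rightarrow> real \<Rightarrow> ram_state" where
  "input_state G xs ys us vs \<theta> =
     \<lparr>nreg = (\<lambda>_. 0)(0 := length xs, 1 := length ys, 2 := length us, 3 := length vs),
      nmem = (\<lambda>_. 0),
      rreg = (\<lambda>_. 0)(0 := \<theta>),
      rmem = (\<lambda>m. if m < length (payoff_table G xs ys us vs)
                  then payoff_table G xs ys us vs ! m else 0)\<rparr>"

definition is_input ::
  "('x, 'y, 'a, 'b) free_game \<Rightarrow> real \<Rightarrow> ram_state \<Rightarrow> bool" where
  "is_input G \<theta> s \<longleftrightarrow>
     (\<exists>xs ys us vs. enumerates xs (questions1 G) \<and> enumerates ys (questions2 G) \<and>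
        enumerates us (answers1 G) \<and> enumerates vs (answers2 G) \<and>
        s = input_state G xs ys us vs \<theta>)"

end

theory Submission
  imports Defs
begin

text \<open>
  A value of 1 means that some pair of strategies wins everywhere. A set \<open>D\<close> of dead answers of
  the second player is refuted in 0 rounds if it leaves some \<open>y\<close> without an answer, and in
  \<open>k + 1\<close> rounds if there is an \<open>x\<close> such that for each answer \<open>a\<close> the set \<open>D\<close>, enlarged by all
  answers that do not win with certainty against \<open>(x, a)\<close>, is refuted in \<open>k\<close> rounds. If the value
  is 1 then the empty set is never refuted. Suppose that the value is at most \<open>\<rho> < 1\<close>. Let the
  second player answer at random among the live answers; some \<open>x\<close> then leaves, whatever \<open>a\<close> is, on
  average over \<open>y\<close> at most a fraction \<open>\<rho>\<close> of the live answers. By concavity the sum over \<open>y\<close> of the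
  logarithm of the number of live answers drops by \<open>ln (1 / \<rho>)\<close> per question, so some \<open>y\<close> loses all
  its answers after little more than \<open>ln |B| / ln (1 / \<rho>)\<close> rounds.

  The program evaluates this alternating formula of depth \<open>K\<close> bottom-up over all
  \<open>(|X| |A|) ^ K\<close> sequences of moves. Since it can neither multiply nor take logarithms, \<open>K\<close> is
  found by adding up a lower bound \<open>\<eta>\<close> of \<open>log 2 (1 / \<rho>)\<close> until \<open>L > log 2 |B|\<close> is
  reached: \<open>\<eta> = \<epsilon>\<close> for \<open>\<rho> = 1 - \<epsilon>\<close>, and for \<open>\<rho> = \<delta>\<close> an approximation found by doubling \<open>\<delta>\<close>.
\<close>

subsection \<open>Total correctness with time bounds\<close>

text \<open>\<open>exec\<close> is deterministic, so the existential speaks about the one run of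
  \<open>P\<close>. \<open>T\<close> is only an upper bound, which lets costs be rounded up while
  programs are composed.\<close>

definition runs :: "prog \<Rightarrow> ram_state \<Rightarrow> nat \<Rightarrow> (ram_state \<Rightarrow> bool) \<Rightarrow> bool" where
  "runs P s T Q \<longleftrightarrow> (\<exists>t s'. exec P s t s' \<and> t \<le> T \<and> Q s')"

lemma runs_mono: "runs P s T Q \<Longrightarrow> T \<le> T' \<Longrightarrow> (\<And>s'. Q s' \<Longrightarrow> Q' s') \<Longrightarrow> runs P s T' Q'"
  unfolding runs_def by (meson le_trans)

lemma runs_Skip: "Q s \<Longrightarrow> 1 \<le> T \<Longrightarrow> runs Skip s T Q"
  unfolding runs_def using exec.Skip by blast

lemma runs_Do: "Q (step i s) \<Longrightarrow> 1 \<le> T \<Longrightarrow> runs (Do i) s T Q"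
  unfolding runs_def using exec.Do by blast

lemma runs_Seq:
  "runs P s T1 R \<Longrightarrow> (\<And>s'. R s' \<Longrightarrow> runs P' s' T2 Q) \<Longrightarrow> T1 + T2 \<le> T \<Longrightarrow> runs (Seq P P') s T Q"
  unfolding runs_def by (meson add_mono exec.Seq order_trans)

lemma runs_Cond:
  assumes "holds c s \<Longrightarrow> runs P s T Q" "\<not> holds c s \<Longrightarrow> runs P' s T Q" "Suc T \<le> T'"
  shows "runs (Cond c P P') s T' Q"
proof (cases "holds c s")
  case True
  then obtain t s' where "exec P s t s'" "t \<le> T" "Q s'" using assms(1) unfolding runs_def by blast
  then show ?thesis unfolding runs_def
    using exec.CondT[OF True, of P t s'] assms(3) by (intro exI[of _ "t + 1"] exI[of _ s']) auto
next
  case False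
  then obtain t s' where "exec P' s t s'" "t \<le> T" "Q s'" using assms(2) unfolding runs_def by blast
  then show ?thesis unfolding runs_def
    using exec.CondF[OF False, of P' t s'] assms(3) by (intro exI[of _ "t + 1"] exI[of _ s']) auto
qed

text \<open>The invariant counts completed iterations, so the loop makes exactly \<open>n\<close> of
  them; each costs the body and one test, and the last, failing test adds 1.\<close>

lemma runs_While:
  assumes "I 0 s"
    and body: "\<And>i s. i < n \<Longrightarrow> I i s \<Longrightarrow> holds c s \<and> runs P s T (I (Suc i))"
    and stop: "\<And>s. I n s \<Longrightarrow> \<not> holds c s"
  shows "runs (While c P) s (n * Suc T + 1) (I n)"
proof -
  have "runs (While c P) s ((n - i) * Suc T + 1) (I n)" if "i \<le> n" "I i s" for i s
    using that
  proof (induction "n - i" arbitrary: i s)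
    case 0
    then have "i = n" by simp
    with 0 show ?case unfolding runs_def
      using exec.WhileF[OF stop, of s P] by (intro exI[of _ 1] exI[of _ s]) auto
  next
    case (Suc d)
    then have i: "i < n" "d = n - Suc i" by auto
    obtain t s' where 1: "exec P s t s'" "t \<le> T" "I (Suc i) s'" and h: "holds c s"
      using body[OF i(1) Suc.prems(2)] unfolding runs_def by blast
    obtain u s'' where 2: "exec (While c P) s' u s''" "u \<le> d * Suc T + 1" "I n s''"
      using Suc.hyps(1)[OF i(2) _ 1(3)] i unfolding runs_def by auto
    have "t + u + 1 \<le> Suc d * Suc T + 1" using 1 2 by simp
    then show ?case unfolding runs_def Suc.hyps(2)[symmetric]
      using exec.WhileT[OF h 1(1) 2(1)] 2(3) by blast
  qed
  from this[of 0 s] assms(1) show ?thesis by simp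
qed

primrec Block :: "instr list \<Rightarrow> prog" where
  "Block [] = Skip"
| "Block (i # is) = Seq (Do i) (Block is)"

lemma runs_Block: "Q (fold step is s) \<Longrightarrow> length is < T \<Longrightarrow> runs (Block is) s T Q"
proof (induction "is" arbitrary: s T)
  case Nil then show ?case by (auto intro: runs_Skip)
next
  case (Cons i "is")
  have "runs (Block is) (step i s) (T - 1) Q" using Cons by auto
  then show ?case using Cons.prems(2)
    by (auto intro!: runs_Seq[where ?T1.0 = 1 and ?T2.0 = "T - 1" and R = "(=) (step i s)"] runs_Do)
qed

text \<open>Register 4 is expected to hold the constant 1.\<close>

definition For :: "nat \<Rightarrow> nat \<Rightarrow> prog \<Rightarrow> prog" where
  "For c n P = Seq (Do (NConst c 0)) (While (NLess c n) (Seq P (Do (NAdd c c 4))))"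

abbreviation set_nreg :: "nat \<Rightarrow> nat \<Rightarrow> ram_state \<Rightarrow> ram_state" where
  "set_nreg c v s \<equiv> s\<lparr>nreg := (nreg s)(c := v)\<rparr>"

text \<open>A round costs the body, the increment and the test, at most \<open>T + 2\<close>;
  initialisation and last test cost 2 more, which \<open>0 < N\<close> spreads over the rounds.
  \<open>I\<close> describes states whose counter is already updated, hence the
  \<open>set_nreg\<close> in the condition on the body.\<close>

lemma runs_For:
  assumes "I 0 (set_nreg c 0 s)"
    and inv: "\<And>i s. i \<le> N \<Longrightarrow> I i s \<Longrightarrow> nreg s c = i \<and> nreg s n = N \<and> nreg s 4 = 1"
    and body: "\<And>i s. i < N \<Longrightarrow> I i s \<Longrightarrow>
      runs P s T (\<lambda>s'. nreg s' 4 = 1 \<and> nreg s' c = i \<and> I (Suc i) (set_nreg c (Suc i) s'))"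
    and "0 < N" and "T + 4 \<le> T'"
  shows "runs (For c n P) s (N * T') (I N)"
  unfolding For_def
proof (rule runs_Seq)
  show "runs (Do (NConst c 0)) s 1 (I 0)" using assms(1) by (auto intro!: runs_Do)
  fix s1 assume I: "I 0 s1"
  show "runs (While (NLess c n) (Seq P (Do (NAdd c c 4)))) s1 (N * Suc (T + 1) + 1) (I N)"
  proof (rule runs_While[where I = I, OF I])
    fix i s assume i: "i < N" "I i s"
    have "runs (Seq P (Do (NAdd c c 4))) s (T + 1) (I (Suc i))"
      by (rule runs_Seq[OF body[OF i]]) (auto intro!: runs_Do)
    then show "holds (NLess c n) s \<and> runs (Seq P (Do (NAdd c c 4))) s (T + 1) (I (Suc i))"
      using inv[OF _ i(2)] i(1) by auto
  next
    fix s assume "I N s" then show "\<not> holds (NLess c n) s" using inv[of N s] by auto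
  qed
next
  have "1 + (N * Suc (T + 1) + 1) \<le> N * (T + 4)" using assms(4) by (cases N) (auto simp: algebra_simps)
  also have "\<dots> \<le> N * T'" using assms(5) by simp
  finally show "1 + (N * Suc (T + 1) + 1) \<le> N * T'" .
qed

section \<open>Lists in memory and loops that append to them\<close>

definition seg :: "(nat \<Rightarrow> nat) \<Rightarrow> nat \<Rightarrow> nat list \<Rightarrow> bool" where
  "seg m b xs \<longleftrightarrow> (\<forall>i<length xs. m (b + i) = xs ! i)"

lemma seg_Nil [simp]: "seg m b []"
  by (simp add: seg_def)

lemma seg_append [simp]: "seg m b (xs @ ys) \<longleftrightarrow> seg m b xs \<and> seg m (b + length xs) ys"
  unfolding seg_def
proof safe
  fix i assume *: "\<forall>i<length (xs @ ys). m (b + i) = (xs @ ys) ! i"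
  show "m (b + i) = xs ! i" if "i < length xs"
    using *[rule_format, of i] that by (simp add: nth_append)
  show "m (b + length xs + i) = ys ! i" if "i < length ys"
    using *[rule_format, of "length xs + i"] that by (simp add: add.assoc)
next
  fix i assume "\<forall>i<length xs. m (b + i) = xs ! i" "\<forall>i<length ys. m (b + length xs + i) = ys ! i"
    "i < length (xs @ ys)"
  then show "m (b + i) = (xs @ ys) ! i"
    by (cases "i < length xs") (auto simp: nth_append dest!: spec[of _ "i - length xs"])
qed

lemma seg_cong: "(\<And>j. b \<le> j \<Longrightarrow> j < b + length xs \<Longrightarrow> m j = m' j) \<Longrightarrow> seg m b xs \<longleftrightarrow> seg m' b xs"
  by (simp add: seg_def)

lemma seg_concat:
  assumes "\<And>i. i < n \<Longrightarrow> length (f i) = l"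
  shows "seg m b (concat (map f [0..<n])) \<longleftrightarrow> (\<forall>i<n. seg m (b + i * l) (f i))"
  using assms
proof (induction n)
  case (Suc n)
  have "map length (map f [0..<n]) = map (\<lambda>_. l) [0..<n]" using Suc.prems by auto
  then have "length (concat (map f [0..<n])) = n * l"
    unfolding length_concat by (simp add: map_replicate_const sum_list_replicate)
  then show ?case using Suc by (auto simp: less_Suc_eq)
qed simp

text \<open>A frame condition: \<open>M\<close> holds the natural registers that may change, and
  real register 3 is scratch space for the payoff being tested. \<open>nmem\<close> is left to
  \<open>emit\<close>.\<close>

definition keeps :: "nat set \<Rightarrow> ram_state \<Rightarrow> ram_state \<Rightarrow> bool" where
  "keeps M s s' \<longleftrightarrow> (\<forall>i. i \<notin> M \<longrightarrow> nreg s' i = nreg s i) \<and> rmem s' = rmem s \<and>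
     (\<forall>i. i \<noteq> 3 \<longrightarrow> rreg s' i = rreg s i)"

lemma keeps_refl [simp]: "keeps M s s"
  by (simp add: keeps_def)

lemma keeps_trans: "keeps M s s1 \<Longrightarrow> keeps M' s1 s2 \<Longrightarrow> M \<union> M' \<subseteq> M'' \<Longrightarrow> keeps M'' s s2"
  unfolding keeps_def by (metis Un_iff subsetD)

text \<open>Output goes to the first free cell, to which register 7 points, and everything below
  stays intact; hence the outputs of successive programs concatenate.\<close>

definition emit :: "nat set \<Rightarrow> nat list \<Rightarrow> ram_state \<Rightarrow> ram_state \<Rightarrow> bool" where
  "emit M xs s s' \<longleftrightarrow> nreg s' 7 = nreg s 7 + length xs \<and> seg (nmem s') (nreg s 7) xs \<and>
     (\<forall>j<nreg s 7. nmem s' j = nmem s j) \<and> keeps M s s'"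

lemma emit_trans:
  assumes "emit M xs s s1" "emit M' ys s1 s2" "M \<union> M' \<subseteq> M''"
  shows "emit M'' (xs @ ys) s s2"
proof -
  have "seg (nmem s2) (nreg s 7) xs \<longleftrightarrow> seg (nmem s1) (nreg s 7) xs"
    using assms by (intro seg_cong) (auto simp: emit_def)
  then show ?thesis using assms keeps_trans[of M s s1 M' s2 M''] by (auto simp: emit_def)
qed

lemma emit_Nil: "nreg s' 7 = nreg s 7 \<Longrightarrow> nmem s' = nmem s \<Longrightarrow> keeps M s s' \<Longrightarrow> emit M [] s s'"
  by (simp add: emit_def)

text \<open>Appending \<open>f i\<close> in round \<open>i\<close> leaves the concatenation.
  \<open>J\<close> carries the pointers that advance with the rounds; the counter \<open>c\<close>
  is in \<open>M\<close> but not in \<open>M'\<close>, so the body leaves it alone.\<close>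

lemma runs_For_emit:
  assumes s: "nreg s 4 = 1" "nreg s n = N" and r: "c \<notin> {4, n, 7}" "insert c M' \<subseteq> M" "n \<notin> M" "4 \<notin> M" "c \<notin> M'"
    and J: "J 0 (set_nreg c 0 s)"
    and body: "\<And>i s1. i < N \<Longrightarrow> emit M (concat (map f [0..<i])) s s1 \<Longrightarrow> J i s1 \<Longrightarrow>
       runs P s1 T (\<lambda>s2. emit M' (f i) s1 s2 \<and> J (Suc i) (set_nreg c (Suc i) s2))"
    and "0 < N" and "T + 4 \<le> T'"
  shows "runs (For c n P) s (N * T') (\<lambda>s'. emit M (concat (map f [0..<N])) s s' \<and> J N s')"
proof -
  let ?I = "\<lambda>i s'. emit M (concat (map f [0..<i])) s s' \<and> nreg s' c = i \<and> J i s'"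
  have "runs (For c n P) s (N * T') (?I N)"
  proof (rule runs_For[where I = ?I and T = T])
    show "?I 0 (set_nreg c 0 s)" using J r by (auto intro!: emit_Nil simp: keeps_def)
  next
    fix i s' assume "?I i s'"
    then show "nreg s' c = i \<and> nreg s' n = N \<and> nreg s' 4 = 1"
      using s r by (auto simp: emit_def keeps_def)
  next
    fix i s1 assume i: "i < N" "?I i s1"
    show "runs P s1 T (\<lambda>s'. nreg s' 4 = 1 \<and> nreg s' c = i \<and> ?I (Suc i) (set_nreg c (Suc i) s'))"
    proof (rule runs_mono[OF body[OF i(1)] order_refl])
      fix s2 assume 2: "emit M' (f i) s1 s2 \<and> J (Suc i) (set_nreg c (Suc i) s2)"
      then have "emit M (concat (map f [0..<i]) @ f i) s s2" using i r
        by (intro emit_trans[of M _ s s1 M']) auto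
      moreover have "nreg s2 c = nreg s1 c" "nreg s2 4 = nreg s1 4" "nreg s1 4 = nreg s 4"
        using 2 i r by (auto simp: emit_def keeps_def)
      ultimately show "nreg s2 4 = 1 \<and> nreg s2 c = i \<and> ?I (Suc i) (set_nreg c (Suc i) s2)"
        using 2 i r s by (auto simp: emit_def keeps_def)
    qed (use i in auto)
  qed (use assms in auto)
  then show ?thesis by (rule runs_mono) auto
qed

subsection \<open>The search program\<close>

type_synonym dead = "nat \<Rightarrow> nat \<Rightarrow> bool"

lemma concat_map_concat: "concat (map h (concat (map g xs))) = concat (map (\<lambda>x. concat (map h (g x))) xs)"
  by (induction xs) auto

lemma map_nth_comp: "map (\<lambda>i. F (xs ! i)) [0..<length xs] = map F xs"
  by (rule nth_equalityI) auto

text \<open>A game reduced to its four sizes and its payoffs by address; for an input,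
  \<open>R\<close> is the real memory.\<close>

locale game_table =
  fixes X Y A B :: nat and R :: "nat \<Rightarrow> real"
  assumes pos: "0 < X" "0 < Y" "0 < A" "0 < B"
begin

text \<open>The address is the row-major position of \<open>(x, y, a, b)\<close>; its summands stand
  in the order \<open>x\<close>, \<open>a\<close>, \<open>y\<close>, \<open>b\<close> in which the
  nested loops add them up.\<close>

definition bad :: "nat \<Rightarrow> nat \<Rightarrow> dead" where
  "bad x a y b \<longleftrightarrow> R (x * (Y * (A * B)) + a * B + y * (A * B) + b) < 1"

definition kill :: "nat \<Rightarrow> nat \<Rightarrow> dead \<Rightarrow> dead" where
  "kill x a D = (\<lambda>y b. D y b \<or> bad x a y b)"

primrec refuted :: "nat \<Rightarrow> dead \<Rightarrow> bool" where
  "refuted 0 D \<longleftrightarrow> (\<exists>y<Y. \<forall>b<B. D y b)"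
| "refuted (Suc k) D \<longleftrightarrow> (\<exists>x<X. \<forall>a<A. refuted k (kill x a D))"

text \<open>Every set takes the same number \<open>Y * B\<close> of cells, so a list of sets is
  addressed without separators.\<close>

definition layout :: "dead \<Rightarrow> nat list" where
  "layout D = concat (map (\<lambda>y. map (\<lambda>b. of_bool (D y b)) [0..<B]) [0..<Y])"

text \<open>The answers \<open>a\<close> to one question \<open>x\<close> are adjacent, so that
  reducing blocks of length \<open>A\<close> and then of length \<open>X\<close> evaluates the two
  quantifiers of \<open>refuted\<close>.\<close>

definition children :: "dead \<Rightarrow> dead list" where
  "children D = concat (map (\<lambda>x. map (\<lambda>a. kill x a D) [0..<A]) [0..<X])"

lemma length_layout [simp]: "length (layout D) = Y * B"
  unfolding layout_def by (simp add: length_concat o_def sum_list_triv)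

lemma length_layouts [simp]: "length (concat (map layout Ds)) = length Ds * (Y * B)"
  by (simp add: length_concat o_def sum_list_triv)

lemma length_children [simp]: "length (children D) = X * A"
  unfolding children_def by (simp add: length_concat o_def sum_list_triv)

text \<open>Registers 0 to 3 keep the sizes and 10, 11, 24 the strides, computed once because there
  is no multiplication instruction. The constant 0 in register 5 turns additions into copies, and
  real register 2 is the payoff 1 to compare with.\<close>

definition ready :: "ram_state \<Rightarrow> bool" where
  "ready s \<longleftrightarrow> nreg s 0 = X \<and> nreg s 1 = Y \<and> nreg s 2 = A \<and> nreg s 3 = B \<and> nreg s 4 = 1 \<and>
     nreg s 5 = 0 \<and> nreg s 10 = A * B \<and> nreg s 11 = Y * (A * B) \<and> nreg s 24 = Y * B \<and>
     rreg s 2 = 1 \<and> rmem s = R"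

lemma ready_keeps: "ready s \<Longrightarrow> keeps M s s' \<Longrightarrow> M \<inter> {0, 1, 2, 3, 4, 5, 10, 11, 24} = {} \<Longrightarrow> ready s'"
  by (auto simp: ready_def keeps_def)

definition arr :: "nat list \<Rightarrow> ram_state \<Rightarrow> bool" where
  "arr xs s \<longleftrightarrow> seg (nmem s) (nreg s 6) xs \<and> nreg s 7 = nreg s 6 + length xs"

end

text \<open>Register 6 points to the current list and register 7 to the first free memory cell;
  19 and 9 point to the current payoff and to the current cell of the parent.\<close>

definition loop_b :: prog where
  "loop_b = For 15 3 (Seq (Block [NLoad 20 9, RLoad 3 19])
     (Seq (Cond (RLess 3 2) (Do (NConst 20 1)) Skip)
     (Block [NStore 7 20, NAdd 7 7 4, NAdd 9 9 4, NAdd 19 19 4])))"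

text \<open>Registers 16 to 19 hold the payoff address at the nesting depths \<open>x\<close>,
  \<open>a\<close>, \<open>y\<close>, \<open>b\<close>; each of the outer three loops hands a copy
  of its pointer inward and then advances it by its stride.\<close>

definition loop_y :: prog where
  "loop_y = For 14 1 (Seq (Block [NAdd 19 18 5]) (Seq loop_b (Block [NAdd 18 18 10])))"

definition loop_a :: prog where
  "loop_a = For 13 2 (Seq (Block [NAdd 9 23 5, NAdd 18 17 5]) (Seq loop_y (Block [NAdd 17 17 3])))"

definition loop_x :: prog where
  "loop_x = For 12 0 (Seq (Block [NAdd 17 16 5]) (Seq loop_a (Block [NAdd 16 16 11])))"

text \<open>The new list begins where the old one ends, so register 6 serves both as the new start
  and as the bound at which register 23, running through the old list, stops.\<close>

definition expand :: prog where
  "expand = Seq (Block [NAdd 23 6 5, NAdd 6 7 5])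
     (While (NLess 23 6) (Seq (Block [NConst 16 0]) (Seq loop_x (Block [NAdd 23 23 24]))))"

section \<open>Correctness and cost of one round of expansion\<close>

context game_table
begin

text \<open>By \<open>le\<close> the cells to be read lie below the first free cell, so appending
  never overwrites them. The factors 16, 25, 35, 44 and 50 here and below grow from loop to loop,
  since each absorbs a constant overhead into a positive product of sizes.\<close>

lemma runs_loop_b:
  assumes "ready s" and rd: "\<And>b. b < B \<Longrightarrow> nmem s (nreg s 9 + b) = of_bool (D b)"
    and le: "nreg s 9 + B \<le> nreg s 7"
  shows "runs loop_b s (B * 16) (\<lambda>s'. emit {7, 9, 15, 19, 20}
    (map (\<lambda>b. of_bool (D b \<or> R (nreg s 19 + b) < 1)) [0..<B]) s s' \<and> nreg s' 9 = nreg s 9 + B)"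
proof -
  let ?f = "\<lambda>b. [of_bool (D b \<or> R (nreg s 19 + b) < 1)] :: nat list"
  let ?J = "\<lambda>i s'. nreg s' 19 = nreg s 19 + i \<and> nreg s' 9 = nreg s 9 + i"
  have len: "length (concat (map ?f [0..<i])) = i" for i by (simp add: length_concat o_def sum_list_triv)
  have "runs loop_b s (B * 16) (\<lambda>s'. emit {7, 9, 15, 19, 20} (concat (map ?f [0..<B])) s s' \<and> ?J B s')"
    unfolding loop_b_def
  proof (rule runs_For_emit[where T = 12 and M' = "{7, 9, 19, 20}"])
    fix i s1 assume i: "i < B" and e: "emit {7, 9, 15, 19, 20} (concat (map ?f [0..<i])) s s1" and J: "?J i s1"
    have r1: "ready s1" using assms(1) e by (auto simp: emit_def intro: ready_keeps)
    have "nmem s1 (nreg s1 9) = nmem s (nreg s 9 + i)" using e J i le by (auto simp: emit_def)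
    then have v: "nmem s1 (nreg s1 9) = of_bool (D i)" using rd i by simp
    let ?Q = "\<lambda>s'. emit {7, 9, 19, 20} (?f i) s1 s' \<and> ?J (Suc i) (set_nreg 15 (Suc i) s')"
    let ?s2 = "fold step [NLoad 20 9, RLoad 3 19] s1"
    \<comment> \<open>Register 20 starts with the parent's bit and is overwritten by 1 if the payoff
      is below 1, which computes the disjunction.\<close>
    let ?s3 = "if R (nreg s 19 + i) < 1 then set_nreg 20 1 ?s2 else ?s2"
    have 4: "?Q (fold step [NStore 7 20, NAdd 7 7 4, NAdd 9 9 4, NAdd 19 19 4] ?s3)"
      using v J r1 by (auto simp: emit_def keeps_def ready_def seg_def)
    show "runs (Seq (Block [NLoad 20 9, RLoad 3 19]) (Seq (Cond (RLess 3 2) (Do (NConst 20 1)) Skip)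
       (Block [NStore 7 20, NAdd 7 7 4, NAdd 9 9 4, NAdd 19 19 4]))) s1 12 ?Q"
    proof (rule runs_Seq[where R = "\<lambda>s'. s' = ?s2" and ?T1.0 = 3 and ?T2.0 = 8])
      fix s' assume "s' = ?s2"
      then show "runs (Seq (Cond (RLess 3 2) (Do (NConst 20 1)) Skip)
       (Block [NStore 7 20, NAdd 7 7 4, NAdd 9 9 4, NAdd 19 19 4])) s' 8 ?Q"
      proof (intro runs_Seq[where R = "\<lambda>s'. s' = ?s3" and ?T1.0 = 2 and ?T2.0 = 5])
        assume s': "s' = ?s2"
        show "runs (Cond (RLess 3 2) (Do (NConst 20 1)) Skip) s' 2 (\<lambda>s'. s' = ?s3)"
          unfolding s' using J r1 
          by (intro runs_Cond[where T = 1] runs_Do runs_Skip) (auto simp: ready_def)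
      next
        fix s' assume s': "s' = ?s3"
        show "runs (Block [NStore 7 20, NAdd 7 7 4, NAdd 9 9 4, NAdd 19 19 4]) s' 5 ?Q"
          unfolding s' by (rule runs_Block, rule 4) simp
      qed simp
    qed (rule runs_Block, simp_all)
  qed (use assms(1) pos in \<open>auto simp: ready_def\<close>)
  then show ?thesis by (rule runs_mono) (auto simp: emit_def keeps_def concat_map_singleton)
qed

lemma runs_loop_y:
  assumes "ready s"
    and rd: "\<And>y b. y < Y \<Longrightarrow> b < B \<Longrightarrow> nmem s (nreg s 9 + (y * B + b)) = of_bool (D y b)"
    and le: "nreg s 9 + Y * B \<le> nreg s 7"
  shows "runs loop_y s (Y * (B * 25)) (emit {7, 9, 14, 15, 18, 19, 20}
    (layout (\<lambda>y b. D y b \<or> R (nreg s 18 + y * (A * B) + b) < 1)) s)"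
proof -
  let ?f = "\<lambda>y. map (\<lambda>b. of_bool (D y b \<or> R (nreg s 18 + y * (A * B) + b) < 1)) [0..<B] :: nat list"
  let ?J = "\<lambda>i s'. nreg s' 18 = nreg s 18 + i * (A * B) \<and> nreg s' 9 = nreg s 9 + i * B"
  let ?M = "{7, 9, 14, 15, 18, 19, 20}"
  have "runs loop_y s (Y * (B * 25)) (\<lambda>s'. emit ?M (concat (map ?f [0..<Y])) s s' \<and> ?J Y s')"
    unfolding loop_y_def
  proof (rule runs_For_emit[where T = "B * 16 + 5" and M' = "{7, 9, 15, 18, 19, 20}"])
    fix i s1 assume i: "i < Y" and e: "emit ?M (concat (map ?f [0..<i])) s s1" and J: "?J i s1"
    let ?Q = "\<lambda>s'. emit {7, 9, 15, 18, 19, 20} (?f i) s1 s' \<and> ?J (Suc i) (set_nreg 14 (Suc i) s')"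
    let ?s2 = "set_nreg 19 (nreg s1 18) s1"
    let ?R = "\<lambda>s'. emit {7, 9, 15, 19, 20} (?f i) ?s2 s' \<and> nreg s' 9 = nreg ?s2 9 + B"
    have r1: "ready s1" using assms(1) e by (auto simp: emit_def intro: ready_keeps)
    then have r2: "ready ?s2" by (simp add: ready_def)
    have b: "Suc i * B \<le> Y * B" using i by (intro mult_right_mono) auto
    show "runs (Seq (Block [NAdd 19 18 5]) (Seq loop_b (Block [NAdd 18 18 10]))) s1 (B * 16 + 5) ?Q"
    proof (rule runs_Seq[where R = "\<lambda>s'. s' = ?s2" and ?T1.0 = 2 and ?T2.0 = "B * 16 + 2"])
      show "runs (Block [NAdd 19 18 5]) s1 2 (\<lambda>s'. s' = ?s2)"
        using r1 by (intro runs_Block) (auto simp: ready_def)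
      fix s' assume s': "s' = ?s2"
      show "runs (Seq loop_b (Block [NAdd 18 18 10])) s' (B * 16 + 2) ?Q"
        unfolding s'
      proof (rule runs_Seq[where R = ?R and ?T2.0 = 2])
        have "nmem ?s2 (nreg ?s2 9 + b) = of_bool (D i b)" if "b < B" for b
        proof -
          have "nreg s 9 + i * B + b < nreg s 7" using le b that by simp
          then show ?thesis using e J rd[OF i that] by (simp add: emit_def add.assoc)
        qed
        moreover have "nreg ?s2 9 + B \<le> nreg ?s2 7" using J e b le by (simp add: emit_def)
        ultimately have "runs loop_b ?s2 (B * 16) (\<lambda>s'. emit {7, 9, 15, 19, 20}
          (map (\<lambda>b. of_bool (D i b \<or> R (nreg ?s2 19 + b) < 1)) [0..<B]) ?s2 s' \<and>
          nreg s' 9 = nreg ?s2 9 + B)"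
          by (intro runs_loop_b r2)
        then show "runs loop_b ?s2 (B * 16) ?R" using J by simp
      next
        fix s3 assume s3: "?R s3"
        then show "runs (Block [NAdd 18 18 10]) s3 2 ?Q"
          using J r1 by (intro runs_Block) (auto simp: emit_def keeps_def ready_def)
      qed simp
    qed simp
  qed (use assms(1) pos in \<open>auto simp: ready_def\<close>)
  then show ?thesis by (rule runs_mono) (auto simp: layout_def)
qed

lemma runs_loop_a:
  assumes "ready s"
    and rd: "\<And>y b. y < Y \<Longrightarrow> b < B \<Longrightarrow> nmem s (nreg s 23 + (y * B + b)) = of_bool (D y b)"
    and le: "nreg s 23 + Y * B \<le> nreg s 7"
  shows "runs loop_a s (A * (Y * (B * 35))) (emit {7, 9, 13, 14, 15, 17, 18, 19, 20} (concat (map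
    (\<lambda>a. layout (\<lambda>y b. D y b \<or> R (nreg s 17 + a * B + y * (A * B) + b) < 1)) [0..<A])) s)"
proof -
  let ?f = "\<lambda>a. layout (\<lambda>y b. D y b \<or> R (nreg s 17 + a * B + y * (A * B) + b) < 1)"
  let ?J = "\<lambda>i s'. nreg s' 17 = nreg s 17 + i * B"
  let ?M = "{7, 9, 13, 14, 15, 17, 18, 19, 20}"
  let ?M' = "{7, 9, 14, 15, 17, 18, 19, 20}"
  have YB: "0 < Y * B" using pos by simp
  have "runs loop_a s (A * (Y * (B * 35))) (\<lambda>s'. emit ?M (concat (map ?f [0..<A])) s s' \<and> ?J A s')"
    unfolding loop_a_def
  proof (rule runs_For_emit[where T = "Y * (B * 25) + 6" and M' = ?M'])
    fix i s1 assume i: "i < A" and e: "emit ?M (concat (map ?f [0..<i])) s s1" and J: "?J i s1"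
    let ?Q = "\<lambda>s'. emit ?M' (?f i) s1 s' \<and> ?J (Suc i) (set_nreg 13 (Suc i) s')"
    let ?s2 = "set_nreg 18 (nreg s1 17) (set_nreg 9 (nreg s1 23) s1)"
    let ?R = "emit {7, 9, 14, 15, 18, 19, 20} (?f i) ?s2"
    have r1: "ready s1" using assms(1) e by (auto simp: emit_def intro: ready_keeps)
    then have r2: "ready ?s2" by (simp add: ready_def)
    show "runs (Seq (Block [NAdd 9 23 5, NAdd 18 17 5]) (Seq loop_y (Block [NAdd 17 17 3]))) s1
      (Y * (B * 25) + 6) ?Q"
    proof (rule runs_Seq[where R = "\<lambda>s'. s' = ?s2" and ?T1.0 = 3 and ?T2.0 = "Y * (B * 25) + 2"])
      show "runs (Block [NAdd 9 23 5, NAdd 18 17 5]) s1 3 (\<lambda>s'. s' = ?s2)"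
        using r1 by (intro runs_Block) (auto simp: ready_def)
      fix s' assume s': "s' = ?s2"
      show "runs (Seq loop_y (Block [NAdd 17 17 3])) s' (Y * (B * 25) + 2) ?Q"
        unfolding s'
      proof (rule runs_Seq[where R = ?R and ?T2.0 = 2])
        have 23: "nreg s1 23 = nreg s 23" using e by (simp add: emit_def keeps_def)
        have "nmem ?s2 (nreg ?s2 9 + (y * B + b)) = of_bool (D y b)" if "y < Y" "b < B" for y b
        proof -
          have "Suc y * B \<le> Y * B" using that by (intro mult_right_mono) auto
          then have "nreg s 23 + (y * B + b) < nreg s 7" using le that by simp
          then show ?thesis using e 23 rd[OF that] by (simp add: emit_def)
        qed
        moreover have "nreg ?s2 9 + Y * B \<le> nreg ?s2 7" using 23 e le by (simp add: emit_def)
        ultimately have "runs loop_y ?s2 (Y * (B * 25)) (emit {7, 9, 14, 15, 18, 19, 20}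
          (layout (\<lambda>y b. D y b \<or> R (nreg ?s2 18 + y * (A * B) + b) < 1)) ?s2)"
          by (intro runs_loop_y r2)
        then show "runs loop_y ?s2 (Y * (B * 25)) ?R" using J by simp
      next
        fix s3 assume s3: "?R s3"
        then show "runs (Block [NAdd 17 17 3]) s3 2 ?Q"
          using J r1 by (intro runs_Block) (auto simp: emit_def keeps_def ready_def)
      qed simp
    qed simp
  qed (use assms(1) pos YB in \<open>auto simp: ready_def mult.assoc[symmetric] simp del: nat_0_less_mult_iff\<close>)
  then show ?thesis by (rule runs_mono) auto
qed

text \<open>With register 16 starting at 0, the addresses tested further in are those of
  \<open>bad\<close>, so the emitted bits are those of \<open>kill x a D\<close>.\<close>

lemma runs_loop_x:
  assumes "ready s" and "nreg s 16 = 0"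
    and rd: "\<And>y b. y < Y \<Longrightarrow> b < B \<Longrightarrow> nmem s (nreg s 23 + (y * B + b)) = of_bool (D y b)"
    and le: "nreg s 23 + Y * B \<le> nreg s 7"
  shows "runs loop_x s (X * (A * (Y * (B * 44))))
    (emit {7, 9, 12, 13, 14, 15, 16, 17, 18, 19, 20} (concat (map layout (children D))) s)"
proof -
  let ?f = "\<lambda>x. concat (map (\<lambda>a. layout (kill x a D)) [0..<A])"
  let ?J = "\<lambda>i s'. nreg s' 16 = i * (Y * (A * B))"
  let ?M = "{7, 9, 12, 13, 14, 15, 16, 17, 18, 19, 20}"
  let ?M' = "{7, 9, 13, 14, 15, 16, 17, 18, 19, 20}"
  have AYB: "0 < A * Y * B" using pos by simp
  have "runs loop_x s (X * (A * (Y * (B * 44)))) (\<lambda>s'. emit ?M (concat (map ?f [0..<X])) s s' \<and> ?J X s')"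
    unfolding loop_x_def
  proof (rule runs_For_emit[where T = "A * (Y * (B * 35)) + 5" and M' = ?M'])
    fix i s1 assume i: "i < X" and e: "emit ?M (concat (map ?f [0..<i])) s s1" and J: "?J i s1"
    let ?Q = "\<lambda>s'. emit ?M' (?f i) s1 s' \<and> ?J (Suc i) (set_nreg 12 (Suc i) s')"
    let ?s2 = "set_nreg 17 (nreg s1 16) s1"
    let ?R = "emit {7, 9, 13, 14, 15, 17, 18, 19, 20} (?f i) ?s2"
    have r1: "ready s1" using assms(1) e by (auto simp: emit_def intro: ready_keeps)
    then have r2: "ready ?s2" by (simp add: ready_def)
    show "runs (Seq (Block [NAdd 17 16 5]) (Seq loop_a (Block [NAdd 16 16 11]))) s1
      (A * (Y * (B * 35)) + 5) ?Q"
    proof (rule runs_Seq[where R = "\<lambda>s'. s' = ?s2" and ?T1.0 = 2 and ?T2.0 = "A * (Y * (B * 35)) + 2"])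
      show "runs (Block [NAdd 17 16 5]) s1 2 (\<lambda>s'. s' = ?s2)"
        using r1 by (intro runs_Block) (auto simp: ready_def)
      fix s' assume s': "s' = ?s2"
      show "runs (Seq loop_a (Block [NAdd 16 16 11])) s' (A * (Y * (B * 35)) + 2) ?Q"
        unfolding s'
      proof (rule runs_Seq[where R = ?R and ?T2.0 = 2])
        have 23: "nreg s1 23 = nreg s 23" using e by (simp add: emit_def keeps_def)
        have "nmem ?s2 (nreg ?s2 23 + (y * B + b)) = of_bool (D y b)" if "y < Y" "b < B" for y b
        proof -
          have "Suc y * B \<le> Y * B" using that by (intro mult_right_mono) auto
          then have "nreg s 23 + (y * B + b) < nreg s 7" using le that by simp
          then show ?thesis using e 23 rd[OF that] by (simp add: emit_def)
        qed
        moreover have "nreg ?s2 23 + Y * B \<le> nreg ?s2 7" using 23 e le by (simp add: emit_def)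
        ultimately have "runs loop_a ?s2 (A * (Y * (B * 35))) (emit {7, 9, 13, 14, 15, 17, 18, 19, 20}
          (concat (map (\<lambda>a. layout (\<lambda>y b. D y b \<or> R (nreg ?s2 17 + a * B + y * (A * B) + b) < 1))
             [0..<A])) ?s2)"
          by (intro runs_loop_a r2)
        then show "runs loop_a ?s2 (A * (Y * (B * 35))) ?R" using J by (simp add: kill_def bad_def)
      next
        fix s3 assume s3: "?R s3"
        then show "runs (Block [NAdd 16 16 11]) s3 2 ?Q"
          using J r1 by (intro runs_Block) (auto simp: emit_def keeps_def ready_def)
      qed simp
    qed simp
  qed (use assms pos AYB in \<open>auto simp: ready_def mult.assoc[symmetric] simp del: nat_0_less_mult_iff\<close>)
  then show ?thesis
    by (rule runs_mono) (auto simp: children_def concat_map_concat o_def)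
qed

lemma layout_read:
  assumes "seg m p (layout D)" "y < Y" "b < B"
  shows "m (p + (y * B + b)) = of_bool (D y b)"
proof -
  have "seg m (p + y * B) (map (\<lambda>b. of_bool (D y b)) [0..<B])"
    using assms(1,2) unfolding layout_def by (subst (asm) seg_concat[where l = B]) auto
  then show ?thesis using assms(3) by (simp add: seg_def add.assoc)
qed

text \<open>The old list lies below all emitted cells and stays intact, so block \<open>i\<close>
  still shows \<open>Ds ! i\<close> when register 23 reaches it.\<close>

lemma runs_expand:
  assumes "ready s" and arr: "arr (concat (map layout Ds)) s"
  shows "runs expand s (length Ds * (X * (A * (Y * (B * 50)))) + 4)
    (\<lambda>s'. arr (concat (map layout (concat (map children Ds)))) s' \<and> keeps ({6, 7, 9, 23} \<union> {12..20}) s s')"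
proof -
  let ?f = "\<lambda>i. concat (map layout (children (Ds ! i)))"
  let ?s0 = "set_nreg 6 (nreg s 7) (set_nreg 23 (nreg s 6) s)"
  let ?M = "{7, 9, 12, 13, 14, 15, 16, 17, 18, 19, 20, 23}"
  let ?M' = "{7, 9, 12, 13, 14, 15, 16, 17, 18, 19, 20}"
  let ?I = "\<lambda>i s'. emit ?M (concat (map ?f [0..<i])) ?s0 s' \<and> nreg s' 23 = nreg s 6 + i * (Y * B)"
  let ?body = "Seq (Block [NConst 16 0]) (Seq loop_x (Block [NAdd 23 23 24]))"
  let ?N = "length Ds"
  have YB: "0 < Y * B" using pos by simp
  have XAYB: "0 < X * (A * (Y * B))" using pos by simp
  have layouts: "seg (nmem s) (nreg s 6 + i * (Y * B)) (layout (Ds ! i))" if "i < ?N" for i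
  proof -
    have "concat (map layout Ds) = concat (map (\<lambda>i. layout (Ds ! i)) [0..<?N])"
      unfolding map_nth_comp ..
    then show ?thesis using arr that by (simp add: arr_def seg_concat[where l = "Y * B"])
  qed
  have w: "nreg s 7 = nreg s 6 + ?N * (Y * B)" using arr by (simp add: arr_def)
  have r0: "ready ?s0" using assms(1) by (simp add: ready_def)
  have rI: "ready s1" if "?I i s1" for i s1
    using that ready_keeps[OF r0, of ?M s1] by (auto simp: emit_def)
  have loop: "runs (While (NLess 23 6) ?body) ?s0 (?N * Suc (X * (A * (Y * (B * 44))) + 4) + 1) (?I ?N)"
  proof (rule runs_While[where I = ?I])
    show "?I 0 ?s0" by (auto intro: emit_Nil)
  next
    fix s1 assume "?I ?N s1"
    then show "\<not> holds (NLess 23 6) s1" using w by (simp add: emit_def keeps_def)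
  next
    fix i s1 assume i: "i < ?N" and I: "?I i s1"
    have ib: "Suc i * (Y * B) \<le> ?N * (Y * B)" using i by (intro mult_right_mono) auto
    have "nreg s1 23 < nreg s1 6"
      using I ib w YB i by (simp add: emit_def keeps_def del: nat_0_less_mult_iff)
    moreover have "runs ?body s1 (X * (A * (Y * (B * 44))) + 4) (?I (Suc i))"
    proof (rule runs_Seq[where R = "\<lambda>s'. s' = set_nreg 16 0 s1" and ?T1.0 = 2
        and ?T2.0 = "X * (A * (Y * (B * 44))) + 2"])
      show "runs (Block [NConst 16 0]) s1 2 (\<lambda>s'. s' = set_nreg 16 0 s1)"
        by (intro runs_Block) auto
      fix s' assume s': "s' = set_nreg 16 0 s1"
      let ?s2 = "set_nreg 16 0 s1"
      let ?R = "emit ?M' (?f i) ?s2"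
      have r2: "ready ?s2" using rI[OF I] by (simp add: ready_def)
      show "runs (Seq loop_x (Block [NAdd 23 23 24])) s' (X * (A * (Y * (B * 44))) + 2) (?I (Suc i))"
        unfolding s'
      proof (rule runs_Seq[where R = ?R and ?T2.0 = 2])
        have "nmem ?s2 (nreg ?s2 23 + (y * B + b)) = of_bool ((Ds ! i) y b)" if "y < Y" "b < B" for y b
        proof -
          have "Suc y * B \<le> Y * B" using that by (intro mult_right_mono) auto
          then have "nreg s 6 + i * (Y * B) + (y * B + b) < nreg s 7"
            using ib w that by simp
          then show ?thesis using I layout_read[OF layouts[OF i] that] by (simp add: emit_def)
        qed
        moreover have "nreg ?s2 23 + Y * B \<le> nreg ?s2 7" using I ib w by (simp add: emit_def)
        ultimately show "runs loop_x ?s2 (X * (A * (Y * (B * 44)))) ?R"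
          by (intro runs_loop_x r2) auto
      next
        fix s3 assume s3: "?R s3"
        have "emit ?M (concat (map ?f [0..<i]) @ ?f i) ?s0 s3"
          by (rule emit_trans[of ?M _ ?s0 "set_nreg 16 0 s1" ?M'])
            (use I s3 in \<open>auto simp: emit_def keeps_def\<close>)
        then show "runs (Block [NAdd 23 23 24]) s3 2 (?I (Suc i))"
          using I s3 rI[OF I] by (intro runs_Block) (auto simp: emit_def keeps_def ready_def)
      qed simp
    qed simp
    ultimately show "holds (NLess 23 6) s1 \<and> runs ?body s1 (X * (A * (Y * (B * 44))) + 4) (?I (Suc i))"
      by simp
  qed
  have cc: "concat (map layout (concat (map children Ds))) = concat (map ?f [0..<?N])"
    unfolding concat_map_concat map_nth_comp[of "\<lambda>D. concat (map layout (children D))"] ..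
  have le: "Suc (X * (A * (Y * (B * 44))) + 4) \<le> X * (A * (Y * (B * 50)))"
  proof -
    have "X * (A * (Y * (B * c))) = c * (X * (A * (Y * B)))" for c by simp
    then show ?thesis using XAYB by linarith
  qed
  have "?N * Suc (X * (A * (Y * (B * 44))) + 4) \<le> ?N * (X * (A * (Y * (B * 50))))"
    using le by (rule mult_left_mono) simp
  moreover have "runs expand s (3 + (?N * Suc (X * (A * (Y * (B * 44))) + 4) + 1)) (?I ?N)"
    unfolding expand_def
  proof (rule runs_Seq[where R = "\<lambda>s'. s' = ?s0"])
    show "runs (Block [NAdd 23 6 5, NAdd 6 7 5]) s 3 (\<lambda>s'. s' = ?s0)"
      using assms(1) by (intro runs_Block) (auto simp: ready_def)
  qed (use loop in auto)
  ultimately show ?thesis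
    by (elim runs_mono) (auto simp: arr_def cc emit_def keeps_def)
qed

end

text \<open>With 1 for true, the conjunction of a block followed by the disjunction over the results is
  twice the operation \<open>nand\<close>, so one reduction serves both kinds of quantifiers.\<close>

definition nand :: "nat list \<Rightarrow> nat" where
  "nand l = of_bool (0 \<in> set l)"

text \<open>\<open>g\<close> names the register with the block length. The results form a new list
  above the old one; comparing with the 1 in register 4 tests for 0.\<close>

definition reduce :: "nat \<Rightarrow> prog" where
  "reduce g = Seq (Block [NAdd 9 6 5, NAdd 6 7 5])
     (While (NLess 9 6) (Seq (Block [NConst 21 0])
       (Seq (For 15 g (Seq (Block [NLoad 20 9, NAdd 9 9 4])
          (Cond (NLess 20 4) (Do (NConst 21 1)) Skip)))
       (Block [NStore 7 21, NAdd 7 7 4]))))"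

lemma runs_reduce_block:
  assumes "seg (nmem s) (nreg s 9) l" "nreg s g = length l" "0 < length l" "nreg s 4 = 1" "nreg s 21 = 0"
    "g \<notin> {9, 15, 20, 21}"
  shows "runs (For 15 g (Seq (Block [NLoad 20 9, NAdd 9 9 4])
          (Cond (NLess 20 4) (Do (NConst 21 1)) Skip))) s (length l * 10)
     (\<lambda>s'. nreg s' 9 = nreg s 9 + length l \<and> nreg s' 21 = nand l \<and> nmem s' = nmem s \<and> keeps {9, 15, 20, 21} s s')"
proof -
  let ?I = "\<lambda>i s'. nreg s' 9 = nreg s 9 + i \<and> nreg s' 21 = nand (take i l) \<and> nreg s' 15 = i \<and>
     nmem s' = nmem s \<and> keeps {9, 15, 20, 21} s s'"
  have "runs (For 15 g (Seq (Block [NLoad 20 9, NAdd 9 9 4])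
          (Cond (NLess 20 4) (Do (NConst 21 1)) Skip))) s (length l * 10) (?I (length l))"
  proof (rule runs_For[where I = ?I and T = 6])
    fix i s1 assume i: "i < length l" and I: "?I i s1"
    let ?s2 = "set_nreg 9 (Suc (nreg s1 9)) (set_nreg 20 (l ! i) s1)"
    have v: "nmem s1 (nreg s1 9) = l ! i" using I assms(1) i by (simp add: seg_def)
    have 4: "nreg s1 4 = 1" using I assms by (simp add: keeps_def)
    have nand: "nand (take (Suc i) l) = (if l ! i = 0 then 1 else nand (take i l))"
      using i by (simp add: nand_def take_Suc_conv_app_nth)
    show "runs (Seq (Block [NLoad 20 9, NAdd 9 9 4]) (Cond (NLess 20 4) (Do (NConst 21 1)) Skip)) s1 6
      (\<lambda>s'. nreg s' 4 = 1 \<and> nreg s' 15 = i \<and> ?I (Suc i) (set_nreg 15 (Suc i) s'))" (is "runs _ _ _ ?Q")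
    proof (rule runs_Seq[where R = "\<lambda>s'. s' = ?s2" and ?T1.0 = 3 and ?T2.0 = 3])
      show "runs (Block [NLoad 20 9, NAdd 9 9 4]) s1 3 (\<lambda>s'. s' = ?s2)"
        using v 4 by (intro runs_Block) (auto simp: fun_upd_twist)
      fix s' assume s': "s' = ?s2"
      show "runs (Cond (NLess 20 4) (Do (NConst 21 1)) Skip) s' 3 ?Q"
        unfolding s' using I i 4 nand
        by (intro runs_Cond[where T = 1] runs_Do runs_Skip) (auto simp: keeps_def)
    qed simp
  qed (use assms in \<open>auto simp: keeps_def nand_def\<close>)
  then show ?thesis by (rule runs_mono) auto
qed

context game_table
begin

lemma runs_reduce:
  assumes "ready s" and arr: "arr (concat ls) s" and len: "\<And>l. l \<in> set ls \<Longrightarrow> length l = nreg s g"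
    and g: "g < 4"
  shows "runs (reduce g) s (length ls * (nreg s g * 17) + 4)
    (\<lambda>s'. arr (map nand ls) s' \<and> keeps {6, 7, 9, 15, 20, 21} s s')"
proof -
  let ?n = "length ls" and ?k = "nreg s g"
  let ?s0 = "set_nreg 6 (nreg s 7) (set_nreg 9 (nreg s 6) s)"
  let ?M = "{7, 9, 15, 20, 21}"
  let ?I = "\<lambda>i s'. emit ?M (map nand (take i ls)) ?s0 s' \<and> nreg s' 9 = nreg s 6 + i * ?k"
  let ?for = "For 15 g (Seq (Block [NLoad 20 9, NAdd 9 9 4]) (Cond (NLess 20 4) (Do (NConst 21 1)) Skip))"
  let ?body = "Seq (Block [NConst 21 0]) (Seq ?for (Block [NStore 7 21, NAdd 7 7 4]))"
  have g4: "g = 0 \<or> g = 1 \<or> g = 2 \<or> g = 3" using g by linarith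
  have k: "0 < ?k" using assms(1) pos g4 by (auto simp: ready_def)
  have ls: "concat ls = concat (map (\<lambda>i. ls ! i) [0..<?n])" by (simp add: map_nth)
  have segs: "seg (nmem s) (nreg s 6 + i * ?k) (ls ! i)" if "i < ?n" for i
    using arr that len unfolding arr_def ls by (simp add: seg_concat[where l = ?k])
  have "length (concat ls) = ?n * ?k"
    unfolding length_concat using len by (induction ls) auto
  then have w: "nreg s 7 = nreg s 6 + ?n * ?k" using arr by (simp add: arr_def)
  have loop: "runs (While (NLess 9 6) ?body) ?s0 (?n * Suc (?k * 10 + 5) + 1) (?I ?n)"
  proof (rule runs_While[where I = ?I])
    show "?I 0 ?s0" by (auto intro: emit_Nil)
  next
    fix s1 assume "?I ?n s1"
    then show "\<not> holds (NLess 9 6) s1" using w by (simp add: emit_def keeps_def)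
  next
    fix i s1 assume i: "i < ?n" and I: "?I i s1"
    have ib: "Suc i * ?k \<le> ?n * ?k" using i by (intro mult_right_mono) auto
    have "nreg s1 9 < nreg s1 6"
      using I ib w k i by (simp add: emit_def keeps_def)
    moreover have "runs ?body s1 (?k * 10 + 5) (?I (Suc i))"
    proof (rule runs_Seq[where R = "\<lambda>s'. s' = set_nreg 21 0 s1" and ?T1.0 = 2 and ?T2.0 = "?k * 10 + 3"])
      show "runs (Block [NConst 21 0]) s1 2 (\<lambda>s'. s' = set_nreg 21 0 s1)"
        by (intro runs_Block) auto
      fix s' assume s': "s' = set_nreg 21 0 s1"
      let ?s2 = "set_nreg 21 0 s1"
      let ?R = "\<lambda>s'. nreg s' 9 = nreg ?s2 9 + ?k \<and> nreg s' 21 = nand (ls ! i) \<and>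
        nmem s' = nmem s1 \<and> keeps {9, 15, 20, 21} ?s2 s'"
      have 4: "nreg s1 4 = 1" using I assms(1) by (simp add: emit_def keeps_def ready_def)
      have gk: "nreg s1 g = ?k" using I g4 by (auto simp: emit_def keeps_def)
      show "runs (Seq ?for (Block [NStore 7 21, NAdd 7 7 4])) s' (?k * 10 + 3) (?I (Suc i))"
        unfolding s'
      proof (rule runs_Seq[where R = ?R and ?T2.0 = 3])
        have "seg (nmem s1) (nreg s 6 + i * ?k) (ls ! i)"
          using segs[OF i] I ib w len[OF nth_mem[OF i]]
          by (subst seg_cong[where m' = "nmem s"]) (auto simp: emit_def)
        then have "runs ?for ?s2 (length (ls ! i) * 10)
          (\<lambda>s'. nreg s' 9 = nreg ?s2 9 + length (ls ! i) \<and> nreg s' 21 = nand (ls ! i) \<and>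
            nmem s' = nmem ?s2 \<and> keeps {9, 15, 20, 21} ?s2 s')"
          using I i len k 4 gk g by (intro runs_reduce_block) auto
        then show "runs ?for ?s2 (?k * 10) ?R" using i len by simp
      next
        fix s3 assume s3: "?R s3"
        have "nreg s3 7 = nreg s1 7" "nreg s3 4 = 1" using s3 4 by (auto simp: keeps_def)
        then have "emit ?M [nand (ls ! i)] s1 (fold step [NStore 7 21, NAdd 7 7 4] s3)"
          using s3 by (auto simp: emit_def seg_def keeps_def)
        then have "emit ?M (map nand (take i ls) @ [nand (ls ! i)]) ?s0 (fold step [NStore 7 21, NAdd 7 7 4] s3)"
          using I by (intro emit_trans[of ?M _ ?s0 s1 ?M]) auto
        then have "?I (Suc i) (fold step [NStore 7 21, NAdd 7 7 4] s3)"
          using I s3 i by (auto simp: take_Suc_conv_app_nth)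
        then show "runs (Block [NStore 7 21, NAdd 7 7 4]) s3 3 (?I (Suc i))"
          by (rule runs_Block) simp
      qed simp
    qed simp
    ultimately show "holds (NLess 9 6) s1 \<and> runs ?body s1 (?k * 10 + 5) (?I (Suc i))"
      by simp
  qed
  have "?n * Suc (?k * 10 + 5) \<le> ?n * (?k * 17)" using k by (intro mult_left_mono) auto
  moreover have "runs (reduce g) s (3 + (?n * Suc (?k * 10 + 5) + 1)) (?I ?n)"
    unfolding reduce_def
  proof (rule runs_Seq[where R = "\<lambda>s'. s' = ?s0"])
    show "runs (Block [NAdd 9 6 5, NAdd 6 7 5]) s 3 (\<lambda>s'. s' = ?s0)"
      using assms(1) by (intro runs_Block) (auto simp: ready_def)
  qed (use loop in auto)
  ultimately show ?thesis
    by (elim runs_mono) (auto simp: arr_def emit_def keeps_def)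
qed

end

text \<open>The \<open>K\<close> expansions produce the leaves; reductions over \<open>b\<close> and
  \<open>y\<close> decide \<open>refuted 0\<close> there; \<open>K\<close> double reductions over
  \<open>a\<close> and \<open>x\<close> climb back to the root. The last block negates, as
  refutation means rejection.\<close>

definition search :: prog where
  "search = Seq (For 25 22 expand) (Seq (Seq (reduce 3) (reduce 1))
     (Seq (For 25 22 (Seq (reduce 2) (reduce 0))) (Block [NLoad 20 6, NSub 0 4 20])))"

lemma nand_map: "nand (map f [0..<n]) = of_bool (\<exists>i<n. f i = 0)"
  by (force simp: nand_def)

lemma nand_nand:
  "nand (map (\<lambda>x. nand (map (\<lambda>a. of_bool (P x a)) [0..<n])) [0..<m]) = of_bool (\<exists>x<m. \<forall>a<n. P x a)"
  by (simp add: nand_map)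

context game_table
begin

text \<open>The nodes at depth \<open>k\<close> of the tree of moves, repetitions included, in the
  order in which memory holds them.\<close>

definition level :: "nat \<Rightarrow> dead list" where
  "level k = ((\<lambda>Ds. concat (map children Ds)) ^^ k) [\<lambda>_ _. False]"

lemma level_Suc: "level (Suc k) = concat (map children (level k))"
  by (simp add: level_def)

lemma length_level: "length (level k) = (X * A) ^ k"
proof (induction k)
  case (Suc k)
  have "length (concat (map children Ds)) = length Ds * (X * A)" for Ds
    by (simp add: length_concat o_def sum_list_triv)
  then show ?case using Suc by (simp add: level_Suc)
qed (simp add: level_def)

text \<open>This evaluates one pair of quantifiers: \<open>h D\<close> is the part of the list
  belonging to \<open>D\<close>, cut into rows. Each reduction costs at most 17 times the total
  number of cells plus 4, whence \<open>42 = 17 + 17 + 8\<close>.\<close>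

lemma runs_reduce_twice:
  assumes s: "ready s" "arr (concat (concat (map h Ds))) s"
    and h: "\<And>D. D \<in> set Ds \<Longrightarrow> length (h D) = nreg s i \<and> (\<forall>l\<in>set (h D). length l = nreg s j)"
    and ij: "i < 4" "j < 4" and "Ds \<noteq> []"
  shows "runs (Seq (reduce j) (reduce i)) s (42 * (length Ds * nreg s i * nreg s j))
    (\<lambda>s'. arr (map (\<lambda>D. nand (map nand (h D))) Ds) s' \<and> keeps {6, 7, 9, 15, 20, 21} s s')"
proof (rule runs_Seq)
  let ?P = "nreg s i * nreg s j"
  have nz: "0 < nreg s m" if "m < 4" for m
  proof -
    have "m = 0 \<or> m = 1 \<or> m = 2 \<or> m = 3" using that by linarith
    then show ?thesis using s(1) pos by (auto simp: ready_def)
  qed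
  have len: "length (concat (map h Ds)) = length Ds * nreg s i"
    using h by (induction Ds) auto
  show "runs (reduce j) s (length Ds * nreg s i * (nreg s j * 17) + 4)
    (\<lambda>s'. arr (map nand (concat (map h Ds))) s' \<and> keeps {6, 7, 9, 15, 20, 21} s s')"
    using runs_reduce[OF s _ ij(2)] h len by auto
  fix s' assume s': "arr (map nand (concat (map h Ds))) s' \<and> keeps {6, 7, 9, 15, 20, 21} s s'"
  then have r: "ready s'" using s(1) by (auto intro: ready_keeps)
  have i: "nreg s' i = nreg s i" using s' ij by (auto simp: keeps_def)
  have a: "arr (concat (map (\<lambda>D. map nand (h D)) Ds)) s'"
    using s' by (simp add: map_concat o_def)
  have l: "length l = nreg s' i" if "l \<in> set (map (\<lambda>D. map nand (h D)) Ds)" for l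
    using that h i by auto
  have "runs (reduce i) s' (length Ds * (nreg s i * 17) + 4)
    (\<lambda>s''. arr (map (\<lambda>D. nand (map nand (h D))) Ds) s'' \<and> keeps {6, 7, 9, 15, 20, 21} s' s'')"
    using runs_reduce[OF r a l ij(1)] i by (simp add: o_def)
  then show "runs (reduce i) s' (length Ds * (nreg s i * 17) + 4)
    (\<lambda>s'. arr (map (\<lambda>D. nand (map nand (h D))) Ds) s' \<and> keeps {6, 7, 9, 15, 20, 21} s s')"
    by (rule runs_mono) (use s' in \<open>auto intro: keeps_trans\<close>)
next
  let ?D = "length Ds" and ?i = "nreg s i" and ?j = "nreg s j"
  have "0 < ?i" "0 < ?j"
    using ij pos s(1) less_Suc_eq by (auto simp: ready_def numeral_eq_Suc)
  then have le: "?D * ?i * 1 \<le> ?D * ?i * ?j" "1 * 1 * 1 \<le> ?D * ?i * ?j"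
    using \<open>Ds \<noteq> []\<close> by (intro mult_mono; simp add: Suc_le_eq)+
  have "?D * ?i * (?j * 17) + 4 + (?D * (?i * 17) + 4) = 17 * (?D * ?i * ?j) + 17 * (?D * ?i * 1) + 8"
    by simp
  also have "\<dots> \<le> 42 * (?D * ?i * ?j)" using le by linarith
  finally show "?D * ?i * (?j * 17) + 4 + (?D * (?i * 17) + 4) \<le> 42 * (?D * ?i * ?j)" .
qed

lemma runs_search:
  assumes s: "ready s" "nreg s 6 = 0" "nreg s 7 = Y * B" "\<And>j. j < Y * B \<Longrightarrow> nmem s j = 0"
    and K: "nreg s 22 = K" "0 < K"
  shows "runs search s (200 * K * (X * Y * A * B) ^ Suc K)
    (\<lambda>s'. accepting s' \<longleftrightarrow> \<not> refuted K (\<lambda>_ _. False))"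
proof -
  let ?W = "(X * Y * A * B) ^ Suc K"
  let ?g = "\<lambda>k D. of_bool (refuted k D) :: nat"
  have ge1: "1 \<le> X * Y * A * B" using pos by (simp add: Suc_le_eq)
  then have W1: "1 \<le> ?W" by (rule one_le_power)
  \<comment> \<open>A level costs its \<open>(X * A) ^ k\<close> sets times at most the size of the
    game, whence the exponent \<open>Suc K\<close>.\<close>
  have size: "length (level k) * (X * (A * (Y * B))) \<le> ?W" if "k \<le> K" for k
  proof -
    have "1 * (X * A) \<le> (Y * B) * (X * A)" using pos by (intro mult_right_mono) (simp_all add: Suc_le_eq)
    then have "X * A \<le> X * Y * A * B" by (simp add: ac_simps)
    then have "(X * A) ^ k * (X * Y * A * B) \<le> (X * Y * A * B) ^ k * (X * Y * A * B)"
      by (intro mult_right_mono power_mono) auto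
    also have "\<dots> = (X * Y * A * B) ^ Suc k" by simp
    also have "\<dots> \<le> ?W" using that by (intro power_increasing ge1) auto
    finally show ?thesis by (simp add: length_level ac_simps)
  qed
  have size2: "length (level k) * X * A \<le> ?W" "length (level k) * Y * B \<le> ?W" if "k \<le> K" for k
  proof -
    let ?l = "length (level k)"
    have "?l * X * A = ?l * (X * A) * 1" by simp
    also have "\<dots> \<le> ?l * (X * A) * (Y * B)" using pos by (intro mult_left_mono) (simp_all add: Suc_le_eq)
    also have "\<dots> = ?l * (X * (A * (Y * B)))" by simp
    finally show "?l * X * A \<le> ?W" using size[OF that] by linarith
    have "?l * Y * B = ?l * (Y * B) * 1" by simp
    also have "\<dots> \<le> ?l * (Y * B) * (X * A)" using pos by (intro mult_left_mono) (simp_all add: Suc_le_eq)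
    also have "\<dots> = ?l * (X * (A * (Y * B)))" by simp
    finally show "?l * Y * B \<le> ?W" using size[OF that] by linarith
  qed
  have level_ne: "level k \<noteq> []" for k
    using length_level[of k] pos by (metis length_0_conv nat_0_less_mult_iff power_not_zero neq0_conv)

  let ?I1 = "\<lambda>i s'. ready s' \<and> nreg s' 22 = K \<and> nreg s' 25 = i \<and> arr (concat (map layout (level i))) s'"
  have 1: "runs (For 25 22 expand) s (K * (58 * ?W)) (?I1 K)"
  proof (rule runs_For[where I = ?I1 and T = "54 * ?W"])
    \<comment> \<open>The empty dead set is laid out as zeros, so the untouched memory already holds
      level 0.\<close>
    have "layout (\<lambda>_ _. False) = replicate (Y * B) 0"
      by (rule replicate_eqI[OF length_layout]) (auto simp: layout_def split: if_splits)
    then show "?I1 0 (set_nreg 25 0 s)" using s K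
      by (auto simp: ready_def level_def arr_def seg_def)
  next
    fix i s1 assume i: "i < K" and I: "?I1 i s1"
    show "runs expand s1 (54 * ?W)
      (\<lambda>s'. nreg s' 4 = 1 \<and> nreg s' 25 = i \<and> ?I1 (Suc i) (set_nreg 25 (Suc i) s'))"
    proof (rule runs_mono[OF runs_expand[of s1 "level i"]])
      have "length (level i) * (X * (A * (Y * (B * 50)))) = 50 * (length (level i) * (X * (A * (Y * B))))"
        by simp
      then show "length (level i) * (X * (A * (Y * (B * 50)))) + 4 \<le> 54 * ?W"
        using size[of i] i W1 by linarith
      fix s' assume "arr (concat (map layout (concat (map children (level i))))) s' \<and>
        keeps ({6, 7, 9, 23} \<union> {12..20}) s1 s'"
      moreover from this I have "ready s'" by (auto intro: ready_keeps)
      ultimately show "nreg s' 4 = 1 \<and> nreg s' 25 = i \<and> ?I1 (Suc i) (set_nreg 25 (Suc i) s')"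
        using I by (auto simp: ready_def arr_def keeps_def level_Suc)
    qed (use I in auto)
  qed (use K W1 in \<open>auto simp: ready_def\<close>)

  have 2: "runs (Seq (reduce 3) (reduce 1)) s1 (42 * ?W)
      (\<lambda>s'. ready s' \<and> nreg s' 22 = K \<and> arr (map (?g 0) (level K)) s')" if I: "?I1 K s1" for s1
  proof -
    let ?h = "\<lambda>D. map (\<lambda>y. map (\<lambda>b. of_bool (D y b)) [0..<B]) [0..<Y] :: nat list list"
    have "concat (map layout Ds) = concat (concat (map ?h Ds))" for Ds
      by (induction Ds) (auto simp: layout_def)
    then have "arr (concat (concat (map ?h (level K)))) s1" using I by simp
    then have "runs (Seq (reduce 3) (reduce 1)) s1 (42 * (length (level K) * nreg s1 1 * nreg s1 3))
      (\<lambda>s'. arr (map (\<lambda>D. nand (map nand (?h D))) (level K)) s' \<and> keeps {6, 7, 9, 15, 20, 21} s1 s')"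
      using I level_ne by (intro runs_reduce_twice) (auto simp: ready_def)
    moreover have "nand (map nand (?h D)) = ?g 0 D" for D
      using nand_nand[of D B Y] by (simp add: o_def)
    moreover have "42 * (length (level K) * nreg s1 1 * nreg s1 3) \<le> 42 * ?W"
      using I size2(2)[of K] by (auto simp: ready_def)
    ultimately show ?thesis
    proof (elim runs_mono)
      fix s' assume *: "arr (map (\<lambda>D. nand (map nand (?h D))) (level K)) s' \<and> keeps {6, 7, 9, 15, 20, 21} s1 s'"
        and n: "\<And>D. nand (map nand (?h D)) = ?g 0 D"
      have "ready s'" using * I by (auto intro: ready_keeps)
      then show "ready s' \<and> nreg s' 22 = K \<and> arr (map (?g 0) (level K)) s'"
        using * I unfolding n by (auto simp: keeps_def)
    qed
  qed

  \<comment> \<open>After \<open>i\<close> double reductions the list holds the truth values of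
    \<open>refuted i\<close> at level \<open>K - i\<close>.\<close>
  let ?I3 = "\<lambda>i s'. ready s' \<and> nreg s' 22 = K \<and> nreg s' 25 = i \<and> i \<le> K \<and>
     arr (map (?g i) (level (K - i))) s'"
  have 3: "runs (For 25 22 (Seq (reduce 2) (reduce 0))) s1 (K * (46 * ?W)) (?I3 K)"
    if "ready s1 \<and> nreg s1 22 = K \<and> arr (map (?g 0) (level K)) s1" for s1
  proof (rule runs_For[where I = ?I3 and T = "42 * ?W"])
    show "?I3 0 (set_nreg 25 0 s1)" using that by (auto simp: ready_def arr_def)
  next
    fix i s1 assume i: "i < K" and I: "?I3 i s1"
    then have k: "K - i = Suc (K - Suc i)" by simp
    let ?h = "\<lambda>D. map (\<lambda>x. map (\<lambda>a. ?g i (kill x a D)) [0..<A]) [0..<X]"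
    have "map (?g i) (concat (map children Ds)) = concat (concat (map ?h Ds))" for Ds
      by (induction Ds) (auto simp: children_def map_concat o_def)
    then have "arr (concat (concat (map ?h (level (K - Suc i))))) s1" using I by (simp add: k level_Suc)
    then have "runs (Seq (reduce 2) (reduce 0)) s1 (42 * (length (level (K - Suc i)) * nreg s1 0 * nreg s1 2))
      (\<lambda>s'. arr (map (\<lambda>D. nand (map nand (?h D))) (level (K - Suc i))) s' \<and> keeps {6, 7, 9, 15, 20, 21} s1 s')"
      using I level_ne by (intro runs_reduce_twice) (auto simp: ready_def)
    moreover have "nand (map nand (?h D)) = ?g (Suc i) D" for D
      using nand_nand[of "\<lambda>x a. refuted i (kill x a D)" A X] by (simp add: o_def)
    moreover have "42 * (length (level (K - Suc i)) * nreg s1 0 * nreg s1 2) \<le> 42 * ?W"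
      using I size2(1)[of "K - Suc i"] by (auto simp: ready_def)
    ultimately have "runs (Seq (reduce 2) (reduce 0)) s1 (42 * ?W)
      (\<lambda>s'. arr (map (?g (Suc i)) (level (K - Suc i))) s' \<and> keeps {6, 7, 9, 15, 20, 21} s1 s')"
      by (elim runs_mono) auto
    then show "runs (Seq (reduce 2) (reduce 0)) s1 (42 * ?W)
      (\<lambda>s'. nreg s' 4 = 1 \<and> nreg s' 25 = i \<and> ?I3 (Suc i) (set_nreg 25 (Suc i) s'))"
    proof (rule runs_mono[OF _ order_refl])
      fix s' assume "arr (map (?g (Suc i)) (level (K - Suc i))) s' \<and> keeps {6, 7, 9, 15, 20, 21} s1 s'"
      moreover from this I have "ready s'" by (auto intro: ready_keeps)
      ultimately show "nreg s' 4 = 1 \<and> nreg s' 25 = i \<and> ?I3 (Suc i) (set_nreg 25 (Suc i) s')"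
        using I i by (auto simp: ready_def arr_def keeps_def)
    qed
  qed (use K W1 in \<open>auto simp: ready_def\<close>)

  \<comment> \<open>Level 0 is a single set, so one cell remains; register 0 becomes 1 minus its
    truth value, as \<open>accepting\<close> wants.\<close>
  have 4: "runs (Block [NLoad 20 6, NSub 0 4 20]) s1 3 (\<lambda>s'. accepting s' \<longleftrightarrow> \<not> refuted K (\<lambda>_ _. False))"
    if "?I3 K s1" for s1
    using that by (intro runs_Block) (auto simp: accepting_def ready_def arr_def level_def seg_def)
  have run: "runs search s (K * (58 * ?W) + (42 * ?W + (K * (46 * ?W) + 3)))
    (\<lambda>s'. accepting s' \<longleftrightarrow> \<not> refuted K (\<lambda>_ _. False))"
    unfolding search_def
    by (rule runs_Seq[OF 1 runs_Seq[OF 2 runs_Seq[OF 3 4 order_refl] order_refl] order_refl])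
  have "1 * ?W \<le> K * ?W" using K by (intro mult_right_mono) auto
  moreover have "K * (58 * w) + (42 * w + (K * (46 * w) + 3)) = 104 * (K * w) + 42 * w + 3"
    "200 * K * w = 200 * (K * w)" for w by simp_all
  ultimately have "K * (58 * ?W) + (42 * ?W + (K * (46 * ?W) + 3)) \<le> 200 * K * ?W" using W1 by linarith
  with run show ?thesis by (rule runs_mono)
qed

end

subsection \<open>The number of rounds\<close>

text \<open>From \<open>1 - \<eta> \<le> exp (- \<eta>)\<close> and \<open>ln 2 < 1\<close>. It lets
  \<epsilon> itself serve as \<eta> when the value is at most \<open>1 - \<epsilon>\<close>.\<close>

lemma one_minus_le_powr:
  fixes \<eta> :: real
  assumes "0 \<le> \<eta>"
  shows "1 - \<eta> \<le> 2 powr - \<eta>"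
proof -
  have "ln 2 * \<eta> \<le> 1 * \<eta>" using assms ln_2_less_1 by (intro mult_right_mono) auto
  then have "exp (- \<eta>) \<le> 2 powr - \<eta>" by (simp add: powr_def mult.commute)
  then show ?thesis using exp_ge_add_one_self[of "- \<eta>"] by linarith
qed


section \<open>Preparation of the constants and choice of the number of rounds\<close>

definition mult :: "nat \<Rightarrow> nat \<Rightarrow> nat \<Rightarrow> prog" where
  "mult d i j = For 12 i (Block [NAdd d d j])"

lemma runs_mult:
  assumes "nreg s 4 = 1" "nreg s d = 0" "0 < nreg s i" "d \<notin> {4, 12, i, j}" "12 \<notin> {i, j}"
  shows "runs (mult d i j) s (nreg s i * 6)
    (\<lambda>s'. s' = s\<lparr>nreg := (nreg s)(d := nreg s i * nreg s j, 12 := nreg s i)\<rparr>)"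
  unfolding mult_def
proof (rule runs_For[where I = "\<lambda>k s'. s' = s\<lparr>nreg := (nreg s)(d := k * nreg s j, 12 := k)\<rparr>" and T = 2])
  show "set_nreg 12 0 s = s\<lparr>nreg := (nreg s)(d := 0 * nreg s j, 12 := 0)\<rparr>"
    using assms by (auto intro!: ram_state.equality)
  fix k s' assume s': "s' = s\<lparr>nreg := (nreg s)(d := k * nreg s j, 12 := k)\<rparr>"
  show "runs (Block [NAdd d d j]) s' 2 (\<lambda>s'. nreg s' 4 = 1 \<and> nreg s' 12 = k \<and>
      set_nreg 12 (Suc k) s' = s\<lparr>nreg := (nreg s)(d := Suc k * nreg s j, 12 := Suc k)\<rparr>)"
    unfolding s' using assms by (intro runs_Block) (auto intro!: ram_state.equality)
qed (use assms in auto)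

text \<open>Register 27 doubles until it exceeds \<open>B\<close> (register 26 is
  \<open>B + 1\<close>), and real register 4 counts the doublings, so it ends as the least
  \<open>L\<close> with \<open>B < 2 ^ L\<close>. It is real because multiples of \<eta> are
  compared with it.\<close>

definition prepare :: prog where
  "prepare = Seq (Block [NConst 4 1]) (Seq (mult 10 2 3) (Seq (mult 11 1 10) (Seq (mult 24 1 3)
     (Seq (Block [NAdd 7 24 5, NAdd 26 3 4, NConst 27 1, RConst 2 1])
     (While (NLess 27 26) (Block [NAdd 27 27 27, RAdd 4 4 2]))))))"

text \<open>Division by repeated addition: \<eta>, in real register 1, is added up until the sum
  reaches \<open>L\<close>, and register 22 is left with the number of additions, the ceiling of
  \<open>L / \<eta>\<close>.\<close>

definition decide :: prog where
  "decide = Seq (While (RLess 5 4) (Block [RAdd 5 5 1, NAdd 22 22 4])) search"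

text \<open>Leaves in real register 1 the integer part of \<open>log 2 (1 / \<delta>)\<close>, cut off at the value of
  register 4 in order to bound the running time, or \<open>1 - \<delta>\<close> if the former is 0.\<close>

definition gain :: prog where
  "gain = Seq (Block [RAdd 7 0 0]) (Seq (While (RLess 6 4) (Seq (Block [RAdd 6 6 2])
     (Cond (RLess 2 7) Skip (Block [RAdd 1 1 2, RAdd 7 7 7]))))
     (Cond (RLess 1 2) (Do (RSub 1 2 0)) Skip))"

context game_table
begin

definition prepared :: "nat \<Rightarrow> real \<Rightarrow> real \<Rightarrow> ram_state \<Rightarrow> bool" where
  "prepared L \<theta> \<eta> s \<longleftrightarrow> ready s \<and> nreg s 6 = 0 \<and> nreg s 7 = Y * B \<and> nmem s = (\<lambda>_. 0) \<and> nreg s 22 = 0 \<and>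
     rreg s 0 = \<theta> \<and> rreg s 1 = \<eta> \<and> rreg s 4 = real L \<and> rreg s 5 = 0"

lemma runs_prepare:
  assumes L: "B < 2 ^ L" "\<And>i. i < L \<Longrightarrow> 2 ^ i \<le> B"
    and s: "nreg s = (\<lambda>_. 0)(0 := X, 1 := Y, 2 := A, 3 := B)" "nmem s = (\<lambda>_. 0)"
      "rreg s = (\<lambda>_. 0)(0 := \<theta>)" "rmem s = R"
  shows "runs prepare s (6 * A + 12 * Y + 4 * L + 8) (\<lambda>s'. prepared L \<theta> 0 s' \<and> rreg s' 6 = 0)"
proof -
  let ?s1 = "set_nreg 4 1 s"
  let ?s2 = "?s1\<lparr>nreg := (nreg ?s1)(10 := A * B, 12 := A)\<rparr>"
  let ?s3 = "?s2\<lparr>nreg := (nreg ?s2)(11 := Y * (A * B), 12 := Y)\<rparr>"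
  let ?s4 = "?s3\<lparr>nreg := (nreg ?s3)(24 := Y * B, 12 := Y)\<rparr>"
  let ?s5 = "?s4\<lparr>nreg := (nreg ?s4)(7 := Y * B, 26 := B + 1, 27 := 1), rreg := (rreg ?s4)(2 := 1)\<rparr>"
  let ?I = "\<lambda>i s'. s' = ?s5\<lparr>nreg := (nreg ?s5)(27 := 2 ^ i), rreg := (rreg ?s5)(4 := real i)\<rparr>"
  have 1: "runs (Block [NConst 4 1]) s 2 (\<lambda>s'. s' = ?s1)"
    by (intro runs_Block) auto
  have 2: "runs (mult 10 2 3) s' (A * 6) (\<lambda>s'. s' = ?s2)" if "s' = ?s1" for s'
    using runs_mult[of ?s1 10 2 3] s pos that by simp
  have 3: "runs (mult 11 1 10) s' (Y * 6) (\<lambda>s'. s' = ?s3)" if "s' = ?s2" for s'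
    using runs_mult[of ?s2 11 1 10] s pos that by simp
  have 4: "runs (mult 24 1 3) s' (Y * 6) (\<lambda>s'. s' = ?s4)" if "s' = ?s3" for s'
    using runs_mult[of ?s3 24 1 3] s pos that by simp
  have 5: "runs (Block [NAdd 7 24 5, NAdd 26 3 4, NConst 27 1, RConst 2 1]) s' 5 (\<lambda>s'. s' = ?s5)" if "s' = ?s4" for s'
    using s that by (intro runs_Block) (auto intro!: ram_state.equality)
  have 6: "runs (While (NLess 27 26) (Block [NAdd 27 27 27, RAdd 4 4 2])) s' (L * Suc 3 + 1) (?I L)" if "s' = ?s5" for s'
  proof (rule runs_While[where I = ?I])
    show "?I 0 s'" using s that by (auto intro!: ram_state.equality)
  next
    fix i s1 assume i: "i < L" and I: "?I i s1"
    have "runs (Block [NAdd 27 27 27, RAdd 4 4 2]) s1 3 (?I (Suc i))"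
      unfolding I using s by (intro runs_Block) (auto intro!: ram_state.equality)
    then show "holds (NLess 27 26) s1 \<and> runs (Block [NAdd 27 27 27, RAdd 4 4 2]) s1 3 (?I (Suc i))"
      using L(2)[OF i] I by simp
  next
    fix s1 assume "?I L s1"
    then show "\<not> holds (NLess 27 26) s1" using L(1) by simp
  qed
  have "runs prepare s (2 + (A * 6 + (Y * 6 + (Y * 6 + (5 + (L * Suc 3 + 1)))))) (?I L)"
    unfolding prepare_def
    by (rule runs_Seq[OF 1 runs_Seq[OF 2 runs_Seq[OF 3 runs_Seq[OF 4 runs_Seq[OF 5 6 order_refl]
      order_refl] order_refl] order_refl] order_refl])
  then show ?thesis
    by (rule runs_mono) (use s in \<open>auto simp: prepared_def ready_def\<close>)
qed

lemma runs_decide: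
  assumes s: "prepared L \<theta> \<eta> s" and L: "0 < L" and \<eta>: "0 < \<eta>" and K: "K = nat \<lceil>real L / \<eta>\<rceil>"
  shows "runs decide s (205 * K * (X * Y * A * B) ^ Suc K) (\<lambda>s'. accepting s' \<longleftrightarrow> \<not> refuted K (\<lambda>_ _. False))"
proof -
  let ?I = "\<lambda>i s'. s' = s\<lparr>nreg := (nreg s)(22 := i), rreg := (rreg s)(5 := real i * \<eta>)\<rparr>"
  have 1: "runs (While (RLess 5 4) (Block [RAdd 5 5 1, NAdd 22 22 4])) s (K * Suc 3 + 1) (?I K)"
  proof (rule runs_While[where I = ?I])
    show "?I 0 s" using s by (auto intro!: ram_state.equality simp: prepared_def)
  next
    fix i s1 assume i: "i < K" and I: "?I i s1"
    have "real i < real L / \<eta>" using i K by linarith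
    then have "real i * \<eta> < real L" using \<eta> by (simp add: pos_less_divide_eq)
    moreover have "runs (Block [RAdd 5 5 1, NAdd 22 22 4]) s1 3 (?I (Suc i))"
      unfolding I using s
      by (intro runs_Block) (auto intro!: ram_state.equality simp: prepared_def ready_def algebra_simps)
    ultimately show "holds (RLess 5 4) s1 \<and> runs (Block [RAdd 5 5 1, NAdd 22 22 4]) s1 3 (?I (Suc i))"
      using I s by (simp add: prepared_def)
  next
    fix s1 assume "?I K s1"
    moreover have "real L / \<eta> \<le> real K" using K by linarith
    then have "real L \<le> real K * \<eta>" using \<eta> by (simp add: pos_divide_le_eq)
    ultimately show "\<not> holds (RLess 5 4) s1" using s by (simp add: prepared_def)
  qed
  have "0 < real L / \<eta>" using L \<eta> by simp
  then have "0 < K" using K by linarith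
  then have 2: "runs search s1 (200 * K * (X * Y * A * B) ^ Suc K)
    (\<lambda>s'. accepting s' \<longleftrightarrow> \<not> refuted K (\<lambda>_ _. False))" if "?I K s1" for s1
    using s that by (intro runs_search) (auto simp: prepared_def ready_def)
  let ?W = "(X * Y * A * B) ^ Suc K"
  have "1 \<le> X * Y * A * B" using pos by (simp add: Suc_le_eq)
  then have "1 \<le> (X * Y * A * B) ^ Suc K" by (rule one_le_power)
  then have "K * 1 \<le> K * (X * Y * A * B) ^ Suc K" by (rule mult_left_mono) simp
  moreover have "200 * K * ?W = 200 * (K * ?W)" "205 * K * ?W = 205 * (K * ?W)" "K * Suc 3 = 4 * K" by simp_all
  ultimately have "(K * Suc 3 + 1) + 200 * K * (X * Y * A * B) ^ Suc K \<le> 205 * K * (X * Y * A * B) ^ Suc K"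
    using \<open>0 < K\<close> by linarith
  then show ?thesis unfolding decide_def
    by (intro runs_Seq[OF 1 2])
qed

text \<open>Let \<open>m\<close> be the integer part of \<open>log 2 (1 / \<delta>)\<close>, cut off
  at \<open>L\<close>. If \<open>m = L\<close> then \<open>L / \<eta> = 1\<close>; if
  \<open>1 \<le> m < L\<close> then \<open>log 2 (1 / \<delta>) < m + 1 \<le> 4 * m\<close>; if
  \<open>m = 0\<close> then \<open>1 / 2 < \<delta>\<close>, and
  \<open>\<eta> = 1 - \<delta>\<close> loses a factor of at most 4.\<close>

lemma runs_gain:
  assumes s: "prepared L \<delta> 0 s" "rreg s 6 = 0" and L: "0 < L" and \<delta>: "0 < \<delta>" "\<delta> < 1"
  shows "runs gain s (7 * L + 6) (\<lambda>s'. \<exists>\<eta>. 0 < \<eta> \<and> \<delta> \<le> 2 powr - \<eta> \<and>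
    real L / \<eta> \<le> 1 + 4 * (real L / log 2 (1 / \<delta>)) \<and> prepared L \<delta> \<eta> s')"
proof -
  \<comment> \<open>\<open>m\<close> counts the doublings that keep \<open>2 ^ m * \<delta>\<close>
    at most 1, stopped at \<open>i\<close>. Real register 7 is one doubling ahead, so that the test
    looks at the next power.\<close>
  define P where "P i m \<longleftrightarrow> m \<le> i \<and> 2 ^ m * \<delta> \<le> 1 \<and> (m = i \<or> 1 < 2 ^ Suc m * \<delta>)" for i m :: nat
  let ?I = "\<lambda>i s'. \<exists>m. P i m \<and> s' = s\<lparr>rreg := (rreg s)(6 := real i, 1 := real m, 7 := 2 ^ Suc m * \<delta>)\<rparr>"
  let ?b = "Seq (Block [RAdd 6 6 2]) (Cond (RLess 2 7) Skip (Block [RAdd 1 1 2, RAdd 7 7 7]))"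
  have 1: "runs (Block [RAdd 7 0 0]) s 2 (?I 0)"
    using s \<delta> by (intro runs_Block) (auto simp: P_def prepared_def intro!: exI[of _ 0] ram_state.equality)
  have 2: "runs (While (RLess 6 4) ?b) s1 (L * Suc 6 + 1) (?I L)" if "?I 0 s1" for s1
  proof (rule runs_While[where I = ?I, OF that])
    fix i s1 assume i: "i < L" and "?I i s1"
    then obtain m where m: "P i m" and
      s1: "s1 = s\<lparr>rreg := (rreg s)(6 := real i, 1 := real m, 7 := 2 ^ Suc m * \<delta>)\<rparr>" by blast
    let ?s2 = "s\<lparr>rreg := (rreg s)(6 := real (Suc i), 1 := real m, 7 := 2 ^ Suc m * \<delta>)\<rparr>"
    have "runs ?b s1 6 (?I (Suc i))"
    proof (rule runs_Seq[where R = "\<lambda>s'. s' = ?s2" and ?T1.0 = 2 and ?T2.0 = 4])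
      show "runs (Block [RAdd 6 6 2]) s1 2 (\<lambda>s'. s' = ?s2)"
        using s unfolding s1
        by (intro runs_Block) (auto intro!: ram_state.equality simp: prepared_def ready_def)
      fix s' assume s': "s' = ?s2"
      show "runs (Cond (RLess 2 7) Skip (Block [RAdd 1 1 2, RAdd 7 7 7])) s' 4 (?I (Suc i))"
        unfolding s'
      proof (rule runs_Cond[where T = 3])
        assume "holds (RLess 2 7) ?s2"
        then have "P (Suc i) m" using m s by (auto simp: P_def prepared_def ready_def)
        then show "runs Skip ?s2 3 (?I (Suc i))" by (auto intro!: runs_Skip)
      next
        assume "\<not> holds (RLess 2 7) ?s2"
        then have "P (Suc i) (Suc m)" using m s by (auto simp: P_def prepared_def ready_def)
        then show "runs (Block [RAdd 1 1 2, RAdd 7 7 7]) ?s2 3 (?I (Suc i))"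
          using s by (intro runs_Block)
            (auto intro!: exI[of _ "Suc m"] ram_state.equality simp: prepared_def ready_def)
      qed simp
    qed simp
    then show "holds (RLess 6 4) s1 \<and> runs ?b s1 6 (?I (Suc i))"
      using s1 s i by (simp add: prepared_def)
  next
    fix s1 assume "?I L s1"
    then show "\<not> holds (RLess 6 4) s1" using s by (auto simp: prepared_def)
  qed
  have log: "0 < log 2 (1 / \<delta>)" using \<delta> by simp
  have 3: "runs (Cond (RLess 1 2) (Do (RSub 1 2 0)) Skip) s1 2 (\<lambda>s'. \<exists>\<eta>. 0 < \<eta> \<and> \<delta> \<le> 2 powr - \<eta> \<and>
    real L / \<eta> \<le> 1 + 4 * (real L / log 2 (1 / \<delta>)) \<and> prepared L \<delta> \<eta> s')" (is "runs _ _ _ ?Q") if I: "?I L s1" for s1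
  proof -
    obtain m where m: "P L m" and
      s1: "s1 = s\<lparr>rreg := (rreg s)(6 := real L, 1 := real m, 7 := 2 ^ Suc m * \<delta>)\<rparr>" using I by blast
    show ?thesis
    proof (rule runs_Cond[where T = 1])
      assume "holds (RLess 1 2) s1"
      then have m0: "m = 0" using s1 s by (simp add: prepared_def ready_def)
      then have "1 < 2 * \<delta>" using m L by (auto simp: P_def)
      \<comment> \<open>The factor 4 is made of two factors 2, one from
        \<open>1 / \<delta> < 2\<close> and one from \<open>1 / 2 \<le> ln 2\<close>.\<close>
      have "ln (1 / \<delta>) \<le> 1 / \<delta> - 1" using ln_le_minus_one[of "1 / \<delta>"] \<delta> by simp
      also have "\<dots> = (1 - \<delta>) / \<delta>" using \<delta> by (simp add: field_simps)
      also have "\<dots> \<le> 2 * (1 - \<delta>)" using \<delta> \<open>1 < 2 * \<delta>\<close>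
        using mult_right_mono[of 1 "2 * \<delta>" "1 - \<delta>"] by (subst pos_divide_le_eq) (auto simp: algebra_simps)
      also have "\<dots> \<le> 4 * ((1 - \<delta>) * ln 2)"
        using mult_left_mono[of "1 / 2" "ln 2" "1 - \<delta>"] ln2_ge_two_thirds \<delta> by linarith
      finally have "ln (1 / \<delta>) \<le> 4 * (1 - \<delta>) * ln 2" by (simp only: mult.assoc)
      then have "log 2 (1 / \<delta>) \<le> 4 * (1 - \<delta>)" unfolding log_def by (subst pos_divide_le_eq) simp_all
      then have "4 * real L / (4 * (1 - \<delta>)) \<le> 4 * real L / log 2 (1 / \<delta>)"
        using log \<delta> by (intro divide_left_mono) auto
      moreover have "4 * real L / (4 * (1 - \<delta>)) = real L / (1 - \<delta>)"
        by (rule mult_divide_mult_cancel_left) simp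
      ultimately have "real L / (1 - \<delta>) \<le> 1 + 4 * (real L / log 2 (1 / \<delta>))" by simp
      moreover have "\<delta> \<le> 2 powr - (1 - \<delta>)" using one_minus_le_powr[of "1 - \<delta>"] \<delta> by simp
      ultimately show "runs (Do (RSub 1 2 0)) s1 1 ?Q"
        using s s1 \<delta> by (intro runs_Do exI[of _ "1 - \<delta>"]) (auto simp: prepared_def ready_def)
    next
      assume "\<not> holds (RLess 1 2) s1"
      then have m1: "1 \<le> real m" using s1 s by (simp add: prepared_def ready_def)
      have "real L / m \<le> 1 + 4 * (real L / log 2 (1 / \<delta>))"
      proof (cases "m = L")
        case False
        then have "1 < 2 ^ Suc m * \<delta>" using m by (auto simp: P_def)
        then have "1 / \<delta> < 2 ^ Suc m" using \<delta> by (simp add: field_simps)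
        then have "1 / \<delta> < 2 powr real (Suc m)" by (subst powr_realpow) simp_all
        then have "log 2 (1 / \<delta>) < real (Suc m)" using \<delta> by (subst log_less_iff) auto
        then have "log 2 (1 / \<delta>) \<le> 4 * m" using m1 by simp
        then have "real L / m \<le> 4 * (real L / log 2 (1 / \<delta>))"
          using log m1 L by (simp add: field_simps)
        then show ?thesis by simp
      qed (use log in simp)
      moreover have "\<delta> \<le> 2 powr - m"
        using m by (simp add: P_def powr_minus powr_realpow field_simps)
      ultimately show "runs Skip s1 1 ?Q"
        using s s1 m1 by (intro runs_Skip exI[of _ "real m"]) (auto simp: prepared_def ready_def)
    qed simp
  qed
  have le: "2 + (L * Suc 6 + 1 + 2) \<le> 7 * L + 6" by simp
  show ?thesis unfolding gain_def
    by (rule runs_Seq[OF 1 runs_Seq[OF 2 3 order_refl] le])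
qed

end

subsection \<open>Refutations and the value of the game\<close>

context game_table
begin

definition val :: "nat \<Rightarrow> nat \<Rightarrow> nat \<Rightarrow> nat \<Rightarrow> real" where
  "val x a y b = R (x * (Y * (A * B)) + a * B + y * (A * B) + b)"

text \<open>Answering each \<open>x\<close> by \<open>f x\<close> defeats every refutation:
  \<open>g y\<close> wins against all these answers, hence is never killed and keeps its row
  nonempty.\<close>

lemma not_refuted:
  assumes f: "\<And>x. x < X \<Longrightarrow> f x < A" and g: "\<And>y. y < Y \<Longrightarrow> g y < B"
    and win: "\<And>x y. x < X \<Longrightarrow> y < Y \<Longrightarrow> 1 \<le> val x (f x) y (g y)"
    and "\<And>y. y < Y \<Longrightarrow> \<not> D y (g y)"
  shows "\<not> refuted k D"
  using assms(4)
proof (induction k arbitrary: D)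
  case 0 then show ?case using g by auto
next
  case (Suc k)
  have "\<not> refuted k (kill x (f x) D)" if "x < X" for x
  proof (rule Suc.IH)
    fix y assume "y < Y"
    then show "\<not> kill x (f x) D y (g y)"
      using Suc.prems win[OF that, of y] by (simp add: kill_def bad_def val_def not_less)
  qed
  then show ?case using f by auto
qed

text \<open>Dead sets only grow, so a row without live answers stays so, and arbitrary moves fill
  the remaining rounds.\<close>

lemma refuted_dead: "y < Y \<Longrightarrow> (\<And>b. b < B \<Longrightarrow> D y b) \<Longrightarrow> refuted k D"
proof (induction k arbitrary: D)
  case (Suc k)
  have "refuted k (kill 0 a D)" for a using Suc by (auto simp: kill_def)
  then show ?case using pos by auto
qed auto

definition alive :: "dead \<Rightarrow> nat \<Rightarrow> nat set" where
  "alive D y = {b. b < B \<and> \<not> D y b}"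

lemma finite_alive [simp]: "finite (alive D y)"
  by (simp add: alive_def)

lemma alive_kill: "alive (kill x a D) y \<subseteq> alive D y"
  by (auto simp: alive_def kill_def)

text \<open>By contradiction and averaging: if every \<open>x\<close> had a reply \<open>f x\<close>
  that keeps too many answers alive, these replies and one suitable live answer \<open>g y\<close>
  per row would form a pair of strategies of value above \<rho>.\<close>

lemma good_move:
  fixes \<rho> :: real
  assumes nonneg: "\<And>x a y b. x < X \<Longrightarrow> a < A \<Longrightarrow> y < Y \<Longrightarrow> b < B \<Longrightarrow> 0 \<le> val x a y b"
    and le: "\<And>f g. (\<And>x. x < X \<Longrightarrow> f x < A) \<Longrightarrow> (\<And>y. y < Y \<Longrightarrow> g y < B) \<Longrightarrow>
      (\<Sum>x<X. \<Sum>y<Y. val x (f x) y (g y)) \<le> \<rho> * X * Y"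
    and D: "\<And>y. y < Y \<Longrightarrow> alive D y \<noteq> {}"
  shows "\<exists>x<X. \<forall>a<A. (\<Sum>y<Y. real (card (alive (kill x a D) y)) / card (alive D y)) \<le> \<rho> * Y"
proof (rule ccontr)
  let ?q = "\<lambda>x a y. real (card (alive (kill x a D) y)) / card (alive D y)"
  assume "\<not> ?thesis"
  then have "\<forall>x\<in>{..<X}. \<exists>a. a < A \<and> \<rho> * Y < (\<Sum>y<Y. ?q x a y)"
    by (simp add: not_le)
  from bchoice[OF this] obtain f
    where f: "\<And>x. x < X \<Longrightarrow> f x < A" "\<And>x. x < X \<Longrightarrow> \<rho> * Y < (\<Sum>y<Y. ?q x (f x) y)" by auto
  \<comment> \<open>A uniformly random live answer reaches the left-hand sum on average, since every
    survivor has payoff at least 1; so some fixed live answer reaches it.\<close>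
  have "\<exists>b. b < B \<and> (\<Sum>x<X. ?q x (f x) y) \<le> (\<Sum>x<X. val x (f x) y b)" if y: "y < Y" for y
  proof -
    let ?n = "real (card (alive D y))"
    have n: "0 < ?n" using D[OF y] by (simp add: card_gt_0_iff)
    have "?q x (f x) y * ?n \<le> (\<Sum>b\<in>alive D y. val x (f x) y b)" if x: "x < X" for x
    proof -
      have "?q x (f x) y * ?n = (\<Sum>b\<in>alive (kill x (f x) D) y. 1)" using n D[OF y] by simp
      also have "\<dots> \<le> (\<Sum>b\<in>alive (kill x (f x) D) y. val x (f x) y b)"
        by (intro sum_mono) (auto simp: alive_def kill_def bad_def val_def not_less)
      also have "\<dots> \<le> (\<Sum>b\<in>alive D y. val x (f x) y b)"
        using nonneg[OF x f(1)[OF x] y] alive_kill by (intro sum_mono2) (auto simp: alive_def)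
      finally show ?thesis .
    qed
    then have "(\<Sum>x<X. ?q x (f x) y) * ?n \<le> (\<Sum>x<X. \<Sum>b\<in>alive D y. val x (f x) y b)"
      unfolding sum_distrib_right by (intro sum_mono) auto
    also have "\<dots> = (\<Sum>b\<in>alive D y. \<Sum>x<X. val x (f x) y b)" by (rule sum.swap)
    finally have *: "(\<Sum>x<X. ?q x (f x) y) * ?n \<le> (\<Sum>b\<in>alive D y. \<Sum>x<X. val x (f x) y b)" .
    have "\<exists>b\<in>alive D y. (\<Sum>x<X. ?q x (f x) y) \<le> (\<Sum>x<X. val x (f x) y b)"
    proof (rule ccontr)
      assume "\<not> ?thesis"
      then have "(\<Sum>b\<in>alive D y. \<Sum>x<X. val x (f x) y b) < (\<Sum>b\<in>alive D y. \<Sum>x<X. ?q x (f x) y)"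
        by (intro sum_strict_mono[OF finite_alive D[OF y]]) (simp add: not_le)
      with * show False by (simp add: mult.commute)
    qed
    then show ?thesis by (auto simp: alive_def)
  qed
  then have "\<forall>y\<in>{..<Y}. \<exists>b. b < B \<and> (\<Sum>x<X. ?q x (f x) y) \<le> (\<Sum>x<X. val x (f x) y b)" by blast
  from bchoice[OF this] obtain g where g: "\<And>y. y < Y \<Longrightarrow> g y < B"
    "\<And>y. y < Y \<Longrightarrow> (\<Sum>x<X. ?q x (f x) y) \<le> (\<Sum>x<X. val x (f x) y (g y))" by auto
  have "(\<Sum>x<X. \<rho> * Y) < (\<Sum>x<X. \<Sum>y<Y. ?q x (f x) y)"
    using f(2) pos by (intro sum_strict_mono) auto
  also have "\<dots> = (\<Sum>y<Y. \<Sum>x<X. ?q x (f x) y)" by (rule sum.swap)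
  also have "\<dots> \<le> (\<Sum>y<Y. \<Sum>x<X. val x (f x) y (g y))" by (rule sum_mono) (use g in auto)
  also have "\<dots> = (\<Sum>x<X. \<Sum>y<Y. val x (f x) y (g y))" by (rule sum.swap)
  also have "\<dots> \<le> \<rho> * X * Y" using f g by (intro le) auto
  finally show False by (simp add: mult_ac)
qed

text \<open>The sum of the logarithms of the row sizes is a potential that a good move lowers by at
  least \<open>- Y * ln \<rho>\<close>. Nonempty rows contribute nonnegative terms, so a negative
  potential reveals an exhausted row.\<close>

lemma refuted_potential:
  fixes \<rho> :: real
  assumes nonneg: "\<And>x a y b. x < X \<Longrightarrow> a < A \<Longrightarrow> y < Y \<Longrightarrow> b < B \<Longrightarrow> 0 \<le> val x a y b"
    and le: "\<And>f g. (\<And>x. x < X \<Longrightarrow> f x < A) \<Longrightarrow> (\<And>y. y < Y \<Longrightarrow> g y < B) \<Longrightarrow>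
      (\<Sum>x<X. \<Sum>y<Y. val x (f x) y (g y)) \<le> \<rho> * X * Y"
    and "0 < \<rho>"
    and "(\<Sum>y<Y. ln (real (card (alive D y)))) < - (k * Y * ln \<rho>)"
  shows "refuted k D"
  using assms(4)
proof (induction k arbitrary: D)
  case 0
  have "\<exists>y<Y. alive D y = {}"
  proof (rule ccontr)
    assume "\<not> ?thesis"
    then have "0 \<le> ln (real (card (alive D y)))" if "y < Y" for y
      using that by (simp add: card_gt_0_iff Suc_le_eq)
    then have "0 \<le> (\<Sum>y<Y. ln (real (card (alive D y))))" by (intro sum_nonneg) auto
    with 0 show False by simp
  qed
  then show ?case by (auto simp: alive_def)
next
  case (Suc k)
  show ?case
  proof (cases "\<exists>y<Y. alive D y = {}")
    case True
    then show ?thesis by (auto simp: alive_def intro: refuted_dead simp del: refuted.simps)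
  next
    case ne: False
    let ?q = "\<lambda>x a y. real (card (alive (kill x a D) y)) / card (alive D y)"
    obtain x where x: "x < X" "\<And>a. a < A \<Longrightarrow> (\<Sum>y<Y. ?q x a y) \<le> \<rho> * Y"
      using good_move[OF nonneg le, of D] ne by blast
    have "refuted k (kill x a D)" if a: "a < A" for a
    \<comment> \<open>Logarithms are informative only for nonempty rows, so an exhausted row is
      treated apart.\<close>
    proof (cases "\<exists>y<Y. alive (kill x a D) y = {}")
      case True
      then show ?thesis by (auto simp: alive_def intro: refuted_dead)
    next
      case False
      \<comment> \<open>Concavity in the form \<open>ln t \<le> t - 1\<close> at
        \<open>t = ?q x a y / \<rho>\<close>. After summation the quotients contribute at most
        \<open>Y\<close>, which cancels the \<open>- Y\<close> and leaves the drop
        \<open>Y * ln \<rho>\<close>.\<close>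
      have "ln (card (alive (kill x a D) y)) \<le> ln (card (alive D y)) + ln \<rho> + ?q x a y / \<rho> - 1" if "y < Y" for y
      proof -
        let ?m = "real (card (alive (kill x a D) y))" and ?n = "real (card (alive D y))"
        have p: "0 < ?m" "0 < ?n" using ne False that by (auto simp: card_gt_0_iff)
        have "ln (?m / ?n / \<rho>) \<le> ?m / ?n / \<rho> - 1" using p \<open>0 < \<rho>\<close> by (intro ln_le_minus_one) simp
        moreover have "ln (?m / ?n / \<rho>) = ln ?m - ln ?n - ln \<rho>"
          using p \<open>0 < \<rho>\<close> by (simp only: ln_divide_pos divide_pos_pos)
        ultimately show ?thesis by linarith
      qed
      then have "(\<Sum>y<Y. ln (card (alive (kill x a D) y)))
        \<le> (\<Sum>y<Y. ln (card (alive D y)) + ln \<rho> + ?q x a y / \<rho> - 1)" by (intro sum_mono) auto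
      also have "\<dots> = (\<Sum>y<Y. ln (card (alive D y))) + Y * ln \<rho> + (\<Sum>y<Y. ?q x a y) / \<rho> - Y"
        by (simp add: sum.distrib sum_subtractf sum_divide_distrib)
      also have "(\<Sum>y<Y. ?q x a y) / \<rho> \<le> Y"
        using x(2)[OF a] \<open>0 < \<rho>\<close> by (simp add: pos_divide_le_eq mult.commute)
      finally have "(\<Sum>y<Y. ln (card (alive (kill x a D) y))) < - (k * Y * ln \<rho>)"
        using Suc.prems by (simp add: algebra_simps)
      then show ?thesis by (rule Suc.IH)
    qed
    then show ?thesis using x(1) by auto
  qed
qed

text \<open>The empty dead set has potential \<open>Y * ln B\<close>, which \<open>B < 2 ^ L\<close>
  and \<open>L \<le> K * \<eta>\<close> put below \<open>K\<close> drops of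
  \<open>Y * \<eta> * ln 2\<close>.\<close>

lemma refuted_initial:
  fixes \<eta> :: real
  assumes nonneg: "\<And>x a y b. x < X \<Longrightarrow> a < A \<Longrightarrow> y < Y \<Longrightarrow> b < B \<Longrightarrow> 0 \<le> val x a y b"
    and le: "\<And>f g. (\<And>x. x < X \<Longrightarrow> f x < A) \<Longrightarrow> (\<And>y. y < Y \<Longrightarrow> g y < B) \<Longrightarrow>
      (\<Sum>x<X. \<Sum>y<Y. val x (f x) y (g y)) \<le> 2 powr - \<eta> * X * Y"
    and K: "real L \<le> K * \<eta>" and L: "B < 2 ^ L"
  shows "refuted K (\<lambda>_ _. False)"
proof (rule refuted_potential[OF nonneg le])
  have "real B < 2 ^ L" using L by (metis of_nat_less_iff of_nat_numeral of_nat_power)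
  then have "ln B < L * ln 2" using pos by (metis ln_less_cancel_iff ln_realpow of_nat_0_less_iff zero_less_numeral zero_less_power)
  also have "\<dots> \<le> K * \<eta> * ln 2" using K by (intro mult_right_mono) auto
  finally have "Y * ln B < Y * (K * \<eta> * ln 2)" using pos by (intro mult_strict_left_mono) auto
  then show "(\<Sum>y<Y. ln (real (card (alive (\<lambda>_ _. False) y)))) < - (K * Y * ln (2 powr - \<eta>))"
    by (simp add: alive_def ln_powr mult_ac)
qed auto

end

section \<open>The game value as a finite sum, and strategies in terms of positions\<close>

lemma strategy_value_eq:
  assumes "is_free_game G"
  shows "strategy_value G a b =
    (\<Sum>x\<in>questions1 G. \<Sum>y\<in>questions2 G. payoff G x y (a x) (b y)) / (card (questions1 G) * card (questions2 G))"
proof -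
  let ?Q1 = "questions1 G" and ?Q2 = "questions2 G"
  have fin: "finite ?Q1" "?Q1 \<noteq> {}" "finite ?Q2" "?Q2 \<noteq> {}" using assms by (auto simp: is_free_game_def)
  have "strategy_value G a b = (\<Sum>p\<in>?Q1 \<times> ?Q2. payoff G (fst p) (snd p) (a (fst p)) (b (snd p)) / (card ?Q1 * card ?Q2))"
    unfolding strategy_value_def using fin
    by (subst integral_measure_pmf[of "?Q1 \<times> ?Q2"])
      (auto intro!: sum.cong simp: pmf_pair split_beta pmf_of_set[OF fin(2,1)] pmf_of_set[OF fin(4,3)])
  also have "\<dots> = (\<Sum>x\<in>?Q1. \<Sum>y\<in>?Q2. payoff G x y (a x) (b y) / (card ?Q1 * card ?Q2))"
    by (simp add: sum.cartesian_product split_beta)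
  finally show ?thesis by (simp add: sum_divide_distrib)
qed

lemma
  assumes G: "is_free_game G"
  shows strategy_value_le_game_value: "a \<in> questions1 G \<rightarrow>\<^sub>E answers1 G \<Longrightarrow> b \<in> questions2 G \<rightarrow>\<^sub>E answers2 G \<Longrightarrow>
      strategy_value G a b \<le> game_value G"
    and game_value_attained: "\<exists>a \<in> questions1 G \<rightarrow>\<^sub>E answers1 G. \<exists>b \<in> questions2 G \<rightarrow>\<^sub>E answers2 G.
      strategy_value G a b = game_value G"
proof -
  let ?SA = "questions1 G \<rightarrow>\<^sub>E answers1 G" and ?SB = "questions2 G \<rightarrow>\<^sub>E answers2 G"
  let ?V = "{strategy_value G a b | a b. a \<in> ?SA \<and> b \<in> ?SB}"
  have V: "?V = (\<lambda>(a, b). strategy_value G a b) ` (?SA \<times> ?SB)" by auto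
  have fin: "finite ?V" unfolding V using G by (auto simp: is_free_game_def intro!: finite_PiE)
  have "?SA \<noteq> {}" "?SB \<noteq> {}" using G by (auto simp: is_free_game_def PiE_eq_empty_iff)
  then have ne: "?V \<noteq> {}" by auto
  show "strategy_value G a b \<le> game_value G" if "a \<in> ?SA" "b \<in> ?SB"
    unfolding game_value_def using fin that by (intro Max_ge) auto
  have "game_value G \<in> ?V" unfolding game_value_def by (rule Max_in[OF fin ne])
  then show "\<exists>a\<in>?SA. \<exists>b\<in>?SB. strategy_value G a b = game_value G" by force
qed

lemma nth_product:
  assumes "i < length xs" "j < length ys"
  shows "List.product xs ys ! (i * length ys + j) = (xs ! i, ys ! j)"
    and "i * length ys + j < length xs * length ys"
proof -
  have "Suc i * length ys \<le> length xs * length ys" using assms(1) by (intro mult_right_mono) auto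
  then show *: "i * length ys + j < length xs * length ys" using assms(2) by simp
  show "List.product xs ys ! (i * length ys + j) = (xs ! i, ys ! j)"
    using product_nth[OF *] assms(2) div_mult_self3[of "length ys" i j] by (cases "ys = []") auto
qed

text \<open>Three uses of \<open>nth_product\<close>, from the innermost pair outward, give the
  row-major position; its summands are then reordered to match \<open>bad\<close>.\<close>

lemma rmem_input_state:
  assumes "x < length xs" "y < length ys" "a < length us" "b < length vs"
  shows "rmem (input_state G xs ys us vs \<theta>)
      (x * (length ys * (length us * length vs)) + a * length vs + y * (length us * length vs) + b) =
    payoff G (xs ! x) (ys ! y) (us ! a) (vs ! b)"
proof -
  let ?uv = "List.product us vs" let ?yuv = "List.product ys ?uv"
  let ?i = "x * length ?yuv + (y * length ?uv + (a * length vs + b))"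
  have 1: "?uv ! (a * length vs + b) = (us ! a, vs ! b)" "a * length vs + b < length ?uv"
    using nth_product[of a us b vs] assms by auto
  have 2: "?yuv ! (y * length ?uv + (a * length vs + b)) = (ys ! y, us ! a, vs ! b)"
    "y * length ?uv + (a * length vs + b) < length ?yuv"
    using nth_product[of y ys "a * length vs + b" ?uv] 1 assms by auto
  have 3: "List.product xs ?yuv ! ?i = (xs ! x, ys ! y, us ! a, vs ! b)" "?i < length (List.product xs ?yuv)"
    using nth_product[of x xs "y * length ?uv + (a * length vs + b)" ?yuv] 2 assms by auto
  have "rmem (input_state G xs ys us vs \<theta>) ?i = payoff G (xs ! x) (ys ! y) (us ! a) (vs ! b)"
    using 3 by (simp only: input_state_def payoff_table_def ram_state.simps length_map nth_map if_True prod.case)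
  moreover have "?i = x * (length ys * (length us * length vs)) + a * length vs + y * (length us * length vs) + b"
    by simp
  ultimately show ?thesis by metis
qed

lemma sum_nth: "distinct xs \<Longrightarrow> (\<Sum>i<length xs. h (xs ! i)) = sum h (set xs)"
  using sum.reindex_bij_betw[OF bij_betw_nth[OF _ refl refl, of xs], of h] by simp

text \<open>The strategies in \<open>game_value\<close> are extensional functions on questions,
  while the search speaks of positions; distinctness makes the position recoverable from the
  question.\<close>

lemma transport:
  assumes "distinct xs" "\<And>i. i < length xs \<Longrightarrow> f i < length us"
  shows "\<exists>a \<in> set xs \<rightarrow>\<^sub>E set us. \<forall>i<length xs. a (xs ! i) = us ! f i"
proof (rule bexI)
  let ?a = "\<lambda>x\<in>set xs. us ! f (inv_into {..<length xs} ((!) xs) x)"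
  have "inv_into {..<length xs} ((!) xs) (xs ! i) = i" if "i < length xs" for i
    using that assms(1) by (intro inv_into_f_f) (auto intro: inj_on_nth)
  then show a: "\<forall>i<length xs. ?a (xs ! i) = us ! f i" by simp
  show "?a \<in> set xs \<rightarrow>\<^sub>E set us"
  proof
    fix x assume "x \<in> set xs"
    then obtain i where "i < length xs" "x = xs ! i" by (auto simp: in_set_conv_nth)
    then show "?a x \<in> set us" using a assms(2) by simp
  qed simp
qed

locale enumerated_game =
  fixes G :: "('x, 'y, 'a, 'b) free_game" and xs ys us vs and \<theta> :: real
  assumes free: "is_free_game G"
    and enum: "enumerates xs (questions1 G)" "enumerates ys (questions2 G)"
      "enumerates us (answers1 G)" "enumerates vs (answers2 G)"
begin

abbreviation input :: ram_state where
  "input \<equiv> input_state G xs ys us vs \<theta>"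

lemma sets: "questions1 G = set xs" "questions2 G = set ys" "answers1 G = set us" "answers2 G = set vs"
  and distinct: "distinct xs" "distinct ys" "distinct us" "distinct vs"
  using enum by (auto simp: enumerates_def)

sublocale game_table "length xs" "length ys" "length us" "length vs" "rmem input"
  using free sets by unfold_locales (auto simp: is_free_game_def)

lemma game_size: "game_size G = length xs * length ys * length us * length vs"
  using sets distinct by (simp add: game_size_def distinct_card)

lemma val_eq: "x < length xs \<Longrightarrow> y < length ys \<Longrightarrow> a < length us \<Longrightarrow> b < length vs \<Longrightarrow>
    val x a y b = payoff G (xs ! x) (ys ! y) (us ! a) (vs ! b)"
  unfolding val_def by (rule rmem_input_state)

lemma payoff_range: "x < length xs \<Longrightarrow> y < length ys \<Longrightarrow> a \<in> set us \<Longrightarrow> b \<in> set vs \<Longrightarrow>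
    payoff G (xs ! x) (ys ! y) a b \<in> {0..1}"
  using free sets nth_mem by (auto simp: is_free_game_def)

lemma strategy_value_nth:
  "strategy_value G a b = (\<Sum>i<length xs. \<Sum>j<length ys. payoff G (xs ! i) (ys ! j) (a (xs ! i)) (b (ys ! j)))
     / (length xs * length ys)"
  unfolding strategy_value_eq[OF free] sets
  by (simp add: distinct distinct_card sum_nth[OF distinct(1), symmetric] sum_nth[OF distinct(2), symmetric])

text \<open>An average of payoffs that are at most 1 equals 1 only if all of them are 1, so an
  optimal pair, translated to positions, wins everywhere.\<close>

lemma game_value_one_not_refuted:
  assumes "game_value G = 1"
  shows "\<not> refuted k (\<lambda>_ _. False)"
proof -
  obtain a b where ab: "a \<in> set xs \<rightarrow>\<^sub>E set us" "b \<in> set ys \<rightarrow>\<^sub>E set vs" "strategy_value G a b = 1"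
    using game_value_attained[OF free] assms sets by auto
  let ?p = "\<lambda>i j. payoff G (xs ! i) (ys ! j) (a (xs ! i)) (b (ys ! j))"
  have le: "?p i j \<le> 1" if "i < length xs" "j < length ys" for i j
    using payoff_range[OF that, of "a (xs ! i)" "b (ys ! j)"] that PiE_mem[OF ab(1)] PiE_mem[OF ab(2)] by simp
  have "(\<Sum>i<length xs. \<Sum>j<length ys. 1 - ?p i j) = 0"
    using ab(3) pos unfolding strategy_value_nth by (simp add: sum_subtractf field_simps)
  then have row: "\<forall>i<length xs. (\<Sum>j<length ys. 1 - ?p i j) = 0"
    using le by (subst (asm) sum_nonneg_eq_0_iff) (auto intro!: sum_nonneg)
  have p: "?p i j = 1" if "i < length xs" "j < length ys" for i j
  proof -
    have "(\<Sum>j<length ys. 1 - ?p i j) = 0" using row that(1) by blast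
    then have "1 - ?p i j = 0" using le that by (subst (asm) sum_nonneg_eq_0_iff) auto
    then show ?thesis by simp
  qed
  have "\<forall>i\<in>{..<length xs}. \<exists>k. k < length us \<and> a (xs ! i) = us ! k"
    using ab(1) by (metis PiE_mem in_set_conv_nth lessThan_iff nth_mem)
  from bchoice[OF this] obtain f where f: "\<And>i. i < length xs \<Longrightarrow> f i < length us \<and> a (xs ! i) = us ! f i" by auto
  have "\<forall>j\<in>{..<length ys}. \<exists>k. k < length vs \<and> b (ys ! j) = vs ! k"
    using ab(2) by (metis PiE_mem in_set_conv_nth lessThan_iff nth_mem)
  from bchoice[OF this] obtain g where g: "\<And>j. j < length ys \<Longrightarrow> g j < length vs \<and> b (ys ! j) = vs ! g j" by auto
  show ?thesis
    using f g p by (intro not_refuted[of f g]) (auto simp: val_eq)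
qed

lemma game_value_le_refuted:
  assumes "game_value G \<le> 2 powr - \<eta>" "real L \<le> real K * \<eta>" "length vs < 2 ^ L"
  shows "refuted K (\<lambda>_ _. False)"
proof (rule refuted_initial[OF _ _ assms(2,3)])
  fix x a y b assume "x < length xs" "a < length us" "y < length ys" "b < length vs"
  then show "0 \<le> val x a y b" using payoff_range[of x y "us ! a" "vs ! b"] by (simp add: val_eq)
next
  fix f g assume f: "\<And>x. x < length xs \<Longrightarrow> f x < length us" and g: "\<And>y. y < length ys \<Longrightarrow> g y < length vs"
  obtain a where a: "a \<in> set xs \<rightarrow>\<^sub>E set us" "\<And>i. i < length xs \<Longrightarrow> a (xs ! i) = us ! f i"
    using transport[OF distinct(1), of f us] f by blast
  obtain b where b: "b \<in> set ys \<rightarrow>\<^sub>E set vs" "\<And>j. j < length ys \<Longrightarrow> b (ys ! j) = vs ! g j"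
    using transport[OF distinct(2), of g vs] g by blast
  have "(\<Sum>x<length xs. \<Sum>y<length ys. val x (f x) y (g y)) =
    (\<Sum>i<length xs. \<Sum>j<length ys. payoff G (xs ! i) (ys ! j) (a (xs ! i)) (b (ys ! j)))"
    using a b f g by (intro sum.cong refl) (simp add: val_eq)
  also have "\<dots> = strategy_value G a b * (length xs * length ys)"
    using pos unfolding strategy_value_nth by simp
  also have "\<dots> \<le> 2 powr - \<eta> * (length xs * length ys)"
    using strategy_value_le_game_value[OF free, of a b] a b assms(1) sets
    by (intro mult_right_mono) auto
  finally show "(\<Sum>x<length xs. \<Sum>y<length ys. val x (f x) y (g y)) \<le> 2 powr - \<eta> * length xs * length ys"
    by simp
qed

end

subsection \<open>Running time\<close>

text \<open>\<open>250 \<le> 2 ^ 8 \<le> n ^ 8\<close> and \<open>K \<le> 2 ^ K \<le> n ^ K\<close>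
  move the coefficients into the exponent, which becomes \<open>8 + K + Suc K\<close>.\<close>

lemma time_le_powr:
  assumes "t \<le> 250 * K * n ^ Suc K" "2 \<le> n" "2 * real K + 9 \<le> e"
  shows "real t \<le> real n powr e"
proof -
  have "(250 :: nat) \<le> 2 ^ 8" by simp
  also have "\<dots> \<le> n ^ 8" using assms(2) by (rule power_mono) simp
  finally have "250 \<le> n ^ 8" .
  moreover have "K \<le> n ^ K" using less_exp[of K] power_mono[OF assms(2), of K] by linarith
  ultimately have "250 * K * n ^ Suc K \<le> n ^ 8 * n ^ K * n ^ Suc K" by (intro mult_mono) auto
  also have "\<dots> = n ^ (8 + K + Suc K)" by (simp only: power_add)
  also have "8 + K + Suc K = 2 * K + 9" by simp
  finally have "real t \<le> real (n ^ (2 * K + 9))" using assms(1) by (simp only: of_nat_le_iff)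
  also have "\<dots> = real n powr real (2 * K + 9)" using assms(2) by (simp add: powr_realpow del: of_nat_add)
  also have "\<dots> \<le> real n powr e" using assms(2,3) by (intro powr_mono) auto
  finally show ?thesis .
qed

context enumerated_game
begin

text \<open>\<open>P\<close> is any preparation that supplies \<eta>. Its allowance
  \<open>43 = 26 + 4 + 7 + 6\<close> is what \<open>prepare\<close> and \<open>gain\<close> need
  together when \<open>L \<le> game_size G\<close>; with the 205 of \<open>decide\<close> it stays
  below 250.\<close>

lemma runs_solver:
  assumes pre: "runs P input (43 * game_size G) (prepared L \<theta>' \<eta>)"
    and L: "0 < L" "length vs < 2 ^ L" and \<eta>: "0 < \<eta>" and K: "K = nat \<lceil>real L / \<eta>\<rceil>"
  shows "\<exists>t s'. exec (Seq P decide) input t s' \<and> t \<le> 250 * K * game_size G ^ Suc K \<and>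
    (game_value G = 1 \<longrightarrow> accepting s') \<and> (game_value G \<le> 2 powr - \<eta> \<longrightarrow> \<not> accepting s')"
proof -
  have "real L / \<eta> \<le> real K" unfolding K by linarith
  moreover have "0 < real L / \<eta>" using L \<eta> by simp
  ultimately have "0 < K" by linarith
  have LK: "real L \<le> real K * \<eta>" using \<open>real L / \<eta> \<le> real K\<close> \<eta> by (simp add: pos_divide_le_eq)
  have n1: "1 \<le> game_size G" using pos by (simp add: game_size Suc_le_eq)
  have "runs (Seq P decide) input (250 * K * game_size G ^ Suc K)
    (\<lambda>s'. accepting s' \<longleftrightarrow> \<not> refuted K (\<lambda>_ _. False))"
  proof (rule runs_Seq[OF pre runs_decide])
    have "1 * game_size G ^ 1 \<le> K * game_size G ^ Suc K"
      using n1 \<open>0 < K\<close> by (intro mult_mono power_increasing) auto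
    then have "game_size G \<le> K * game_size G ^ Suc K" by simp
    moreover have "205 * K * (length xs * length ys * length us * length vs) ^ Suc K =
      205 * (K * game_size G ^ Suc K)" "250 * K * game_size G ^ Suc K = 250 * (K * game_size G ^ Suc K)"
      by (simp_all add: game_size)
    ultimately show "43 * game_size G + 205 * K * (length xs * length ys * length us * length vs) ^ Suc K
      \<le> 250 * K * game_size G ^ Suc K" by linarith
  qed (use L \<eta> K in auto)
  then show ?thesis
    using game_value_one_not_refuted game_value_le_refuted[OF _ LK L(2)] unfolding runs_def by blast
qed

text \<open>For the least \<open>L\<close> with \<open>length vs < 2 ^ L\<close>, minimality bounds
  \<open>2 ^ (L - 1)\<close> by the game size \<open>n\<close>. So \<open>L\<close> is at most
  \<open>1 + log 2 n\<close>, hence at most \<open>2 * log 2 n\<close> as soon as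
  \<open>2 \<le> n\<close>.\<close>

lemma log_size:
  "\<exists>L>0. length vs < 2 ^ L \<and> (\<forall>i<L. 2 ^ i \<le> length vs) \<and> L \<le> game_size G \<and>
    (2 \<le> game_size G \<longrightarrow> real L \<le> 2 * log 2 (game_size G))"
proof (intro exI conjI allI impI)
  let ?L = "LEAST l. length vs < 2 ^ l"
  show lt: "length vs < 2 ^ ?L" by (rule LeastI[of _ "length vs"]) (rule less_exp)
  show least: "2 ^ i \<le> length vs" if "i < ?L" for i using not_less_Least[OF that] by simp
  show "0 < ?L" using lt pos by (cases ?L) auto
  have "1 * length vs \<le> (length xs * length ys * length us) * length vs"
    using pos by (intro mult_right_mono) (auto simp: Suc_le_eq)
  then have le: "length vs \<le> game_size G" by (simp add: game_size)
  have pow: "2 ^ (?L - 1) \<le> length vs" using least[of "?L - 1"] \<open>0 < ?L\<close> by simp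
  then show "?L \<le> game_size G" using less_exp[of "?L - 1"] le by linarith
  assume n: "2 \<le> game_size G"
  have "real (2 ^ (?L - 1)) \<le> real (game_size G)" using pow le by (simp only: of_nat_le_iff)
  then have "(2::real) ^ (?L - 1) \<le> game_size G" by simp
  then have "real (?L - 1) \<le> log 2 (game_size G)" using n by (simp add: le_log_iff powr_realpow)
  moreover have "1 \<le> log 2 (game_size G)" using n by simp
  ultimately show "real ?L \<le> 2 * log 2 (game_size G)" using \<open>0 < ?L\<close> by linarith
qed

lemma runs_prepare_input:
  assumes "length vs < 2 ^ L" "\<And>i. i < L \<Longrightarrow> 2 ^ i \<le> length vs"
  shows "runs prepare input (26 * game_size G + 4 * L) (\<lambda>s'. prepared L \<theta> 0 s' \<and> rreg s' 6 = 0)"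
proof -
  have "1 * length us \<le> (length xs * length ys * length vs) * length us"
    "1 * length ys \<le> (length xs * length us * length vs) * length ys"
    using pos by (intro mult_right_mono; simp add: Suc_le_eq)+
  moreover have "1 \<le> length us" using pos(3) by linarith
  moreover have "(length xs * length ys * length vs) * length us = game_size G"
    "(length xs * length us * length vs) * length ys = game_size G" by (simp_all add: game_size)
  ultimately have "6 * length us + 12 * length ys + 4 * L + 8 \<le> 26 * game_size G + 4 * L" by linarith
  moreover have "runs prepare input (6 * length us + 12 * length ys + 4 * L + 8)
    (\<lambda>s'. prepared L \<theta> 0 s' \<and> rreg s' 6 = 0)"
    by (rule runs_prepare[OF assms]) (auto simp: input_state_def)
  ultimately show ?thesis by (elim runs_mono)
qed

lemma decides_eps:
  assumes \<theta>: "0 < \<theta>" "\<theta> \<le> 1"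
  shows "\<exists>t s'. exec (Seq (Seq prepare (Block [RAdd 1 0 6])) decide) input t s' \<and>
    (2 \<le> game_size G \<longrightarrow> real t \<le> real (game_size G) powr (15 * ((1 / \<theta>) * log 2 (game_size G)))) \<and>
    (game_value G = 1 \<longrightarrow> accepting s') \<and> (game_value G \<le> 1 - \<theta> \<longrightarrow> \<not> accepting s')"
proof -
  obtain L where L: "0 < L" "length vs < 2 ^ L" "\<And>i. i < L \<Longrightarrow> 2 ^ i \<le> length vs" "L \<le> game_size G"
    "2 \<le> game_size G \<Longrightarrow> real L \<le> 2 * log 2 (game_size G)" using log_size by blast
  let ?K = "nat \<lceil>real L / \<theta>\<rceil>"
  have pre: "runs (Seq prepare (Block [RAdd 1 0 6])) input (43 * game_size G) (prepared L \<theta> \<theta>)"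
  proof (rule runs_Seq[OF runs_prepare_input[OF L(2,3)]])
    fix s' assume "prepared L \<theta> 0 s' \<and> rreg s' 6 = 0"
    \<comment> \<open>Real register 6 is 0, so the instruction copies the threshold, which is \<eta>
      here.\<close>
    then show "runs (Block [RAdd 1 0 6]) s' 2 (prepared L \<theta> \<theta>)"
      by (intro runs_Block) (auto simp: prepared_def ready_def)
  qed (use L in linarith)+
  obtain t s' where ts: "exec (Seq (Seq prepare (Block [RAdd 1 0 6])) decide) input t s'"
    "t \<le> 250 * ?K * game_size G ^ Suc ?K"
    "game_value G = 1 \<longrightarrow> accepting s'" "game_value G \<le> 2 powr - \<theta> \<longrightarrow> \<not> accepting s'"
    using runs_solver[OF pre L(1,2) \<theta>(1) refl] by blast
  have "real t \<le> real (game_size G) powr (15 * ((1 / \<theta>) * log 2 (game_size G)))" if n: "2 \<le> game_size G"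
  proof (rule time_le_powr[OF ts(2) n])
    let ?E = "(1 / \<theta>) * log 2 (game_size G)"
    have "1 \<le> log 2 (game_size G)" using n by simp
    then have "1 * 1 \<le> ?E" using \<theta> by (intro mult_mono) auto
    moreover have "real L / \<theta> \<le> 2 * log 2 (game_size G) / \<theta>"
      using L(5)[OF n] \<theta> by (intro divide_right_mono) auto
    then have "real L / \<theta> \<le> 2 * ?E" by simp
    moreover have "real ?K < real L / \<theta> + 1" using L(1) \<theta> by (simp add: ceiling_correct) linarith
    \<comment> \<open>From \<open>?K < 2 * ?E + 1\<close> the left side is below
      \<open>4 * ?E + 11\<close>; \<open>1 \<le> ?E\<close>, which rests on
      \<open>\<theta> \<le> 1\<close>, absorbs the 11.\<close>
    ultimately show "2 * real ?K + 9 \<le> 15 * ?E" by linarith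
  qed
  moreover have "\<not> accepting s'" if "game_value G \<le> 1 - \<theta>"
    using ts(4) that one_minus_le_powr[of \<theta>] \<theta> by simp
  ultimately show ?thesis using ts by blast
qed

lemma decides_delta:
  assumes \<theta>: "0 < \<theta>" "\<theta> < 1"
  shows "\<exists>t s'. exec (Seq (Seq prepare gain) decide) input t s' \<and>
    (2 \<le> game_size G \<longrightarrow>
      real t \<le> real (game_size G) powr (25 * (1 + log 2 (game_size G) / log 2 (1 / \<theta>)))) \<and>
    (game_value G = 1 \<longrightarrow> accepting s') \<and> (game_value G < \<theta> \<longrightarrow> \<not> accepting s')"
proof -
  obtain L where L: "0 < L" "length vs < 2 ^ L" "\<And>i. i < L \<Longrightarrow> 2 ^ i \<le> length vs" "L \<le> game_size G"
    "2 \<le> game_size G \<Longrightarrow> real L \<le> 2 * log 2 (game_size G)" using log_size by blast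
  have "runs (Seq prepare gain) input (43 * game_size G) (\<lambda>s'. \<exists>\<eta>. 0 < \<eta> \<and> \<theta> \<le> 2 powr - \<eta> \<and>
      real L / \<eta> \<le> 1 + 4 * (real L / log 2 (1 / \<theta>)) \<and> prepared L \<theta> \<eta> s')"
    (is "runs _ _ _ ?Q")
  proof (rule runs_Seq[OF runs_prepare_input[OF L(2,3)]])
    fix s' assume "prepared L \<theta> 0 s' \<and> rreg s' 6 = 0"
    then show "runs gain s' (7 * L + 6) ?Q" using L(1) \<theta> by (intro runs_gain) simp_all
  qed (use L in linarith)+
  \<comment> \<open>The gain is found by the program and so stands inside the postcondition; the
    final state of the run fixes it, and with it \<open>?K\<close>.\<close>
  then obtain \<eta> where \<eta>: "0 < \<eta>" "\<theta> \<le> 2 powr - \<eta>" "real L / \<eta> \<le> 1 + 4 * (real L / log 2 (1 / \<theta>))"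
    and pre: "runs (Seq prepare gain) input (43 * game_size G) (prepared L \<theta> \<eta>)"
    unfolding runs_def by blast
  let ?K = "nat \<lceil>real L / \<eta>\<rceil>"
  obtain t s' where ts: "exec (Seq (Seq prepare gain) decide) input t s'"
    "t \<le> 250 * ?K * game_size G ^ Suc ?K"
    "game_value G = 1 \<longrightarrow> accepting s'" "game_value G \<le> 2 powr - \<eta> \<longrightarrow> \<not> accepting s'"
    using runs_solver[OF pre L(1,2) \<eta>(1) refl] by blast
  have "real t \<le> real (game_size G) powr (25 * (1 + log 2 (game_size G) / log 2 (1 / \<theta>)))" if n: "2 \<le> game_size G"
  proof (rule time_le_powr[OF ts(2) n])
    let ?q = "log 2 (game_size G) / log 2 (1 / \<theta>)"
    have \<theta>_log: "0 < log 2 (1 / \<theta>)" using \<theta> by simp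
    then have "0 \<le> ?q" using n by simp
    moreover have "real L / log 2 (1 / \<theta>) \<le> 2 * log 2 (game_size G) / log 2 (1 / \<theta>)"
      using L(5)[OF n] \<theta>_log by (intro divide_right_mono) auto
    then have "real L / \<eta> \<le> 1 + 8 * ?q" using \<eta>(3) by simp
    moreover have "real ?K < real L / \<eta> + 1" using L(1) \<eta>(1) by (simp add: ceiling_correct) linarith
    \<comment> \<open>Here \<open>?K < 2 + 8 * ?q\<close>, so the left side is below
      \<open>13 + 16 * ?q\<close>. As \<open>?q\<close> may be arbitrarily close to 0, the constant
      is paid by the summand 1 of the exponent.\<close>
    moreover have "2 * k + 9 \<le> 25 * (1 + q)" if "0 \<le> q" "l \<le> 1 + 8 * q" "k < l + 1" for k l q :: real
      using that by simp
    ultimately show "2 * real ?K + 9 \<le> 25 * (1 + ?q)" by blast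
  qed
  moreover have "\<not> accepting s'" if "game_value G < \<theta>"
    using ts(4) that \<eta>(2) by simp
  ultimately show ?thesis using ts by blast
qed

end

lemma is_input_enumerated:
  assumes "is_free_game G" "is_input G \<theta> s"
  obtains xs ys us vs where "enumerated_game G xs ys us vs" "s = input_state G xs ys us vs \<theta>"
  using assms unfolding is_input_def enumerated_game_def by blast


theorem theorem40:
  shows
  "(\<exists>(P :: prog) (C :: real).
      \<forall>(G :: ('x, 'y, 'a, 'b) free_game) (\<epsilon> :: real) s.
        is_free_game G \<and> 0 < \<epsilon> \<and> \<epsilon> \<le> 1 \<and> is_input G \<epsilon> s \<longrightarrow>
        (\<exists>t s'. exec P s t s' \<and>
           (game_size G \<ge> 2 \<longrightarrow>
              real t \<le> real (game_size G) powr
                (C * ((1 / \<epsilon>) * log 2 (real (game_size G))))) \<and>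
           (game_value G = 1 \<longrightarrow> accepting s') \<and>
           (game_value G \<le> 1 - \<epsilon> \<longrightarrow> \<not> accepting s'))) \<and>
   (\<exists>(P :: prog) (C :: real).
      \<forall>(G :: ('x, 'y, 'a, 'b) free_game) (\<delta> :: real) s.
        is_free_game G \<and> 0 < \<delta> \<and> \<delta> < 1 \<and> is_input G \<delta> s \<longrightarrow>
        (\<exists>t s'. exec P s t s' \<and>
           (game_size G \<ge> 2 \<longrightarrow>
              real t \<le> real (game_size G) powr
                (C * (1 + log 2 (real (game_size G)) / log 2 (1 / \<delta>)))) \<and>
           (game_value G = 1 \<longrightarrow> accepting s') \<and>
           (game_value G < \<delta> \<longrightarrow> \<not> accepting s')))"
proof (intro conjI)
  show "\<exists>(P :: prog) (C :: real).
      \<forall>(G :: ('x, 'y, 'a, 'b) free_game) (\<epsilon> :: real) s.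
        is_free_game G \<and> 0 < \<epsilon> \<and> \<epsilon> \<le> 1 \<and> is_input G \<epsilon> s \<longrightarrow>
        (\<exists>t s'. exec P s t s' \<and>
           (game_size G \<ge> 2 \<longrightarrow>
              real t \<le> real (game_size G) powr
                (C * ((1 / \<epsilon>) * log 2 (real (game_size G))))) \<and>
           (game_value G = 1 \<longrightarrow> accepting s') \<and>
           (game_value G \<le> 1 - \<epsilon> \<longrightarrow> \<not> accepting s'))"
    by (rule exI[of _ "Seq (Seq prepare (Block [RAdd 1 0 6])) decide"], rule exI[of _ 15])
      (metis is_input_enumerated enumerated_game.decides_eps)
  show "\<exists>(P :: prog) (C :: real).
      \<forall>(G :: ('x, 'y, 'a, 'b) free_game) (\<delta> :: real) s.
        is_free_game G \<and> 0 < \<delta> \<and> \<delta> < 1 \<and> is_input G \<delta> s \<longrightarrow>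
        (\<exists>t s'. exec P s t s' \<and>
           (game_size G \<ge> 2 \<longrightarrow>
              real t \<le> real (game_size G) powr
                (C * (1 + log 2 (real (game_size G)) / log 2 (1 / \<delta>)))) \<and>
           (game_value G = 1 \<longrightarrow> accepting s') \<and>
           (game_value G < \<delta> \<longrightarrow> \<not> accepting s'))"
    by (rule exI[of _ "Seq (Seq prepare gain) decide"], rule exI[of _ 25])
      (metis is_input_enumerated enumerated_game.decides_delta)
qed

end
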